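(* Let $G$ be a centered Gaussian measure on $T_\lambda$ with covariance operator $A^{-1}$. Suppose that $G\big(C^1(\mathbb R^d,\mathbb R^d)\big)=1$ and that there exists an eigenvector $g\in C^1(\mathbb R^d,\mathbb R^d)$ of $A$ with $\lambda(\{x:\det(Jg(x))=0\})=0$. Then $$G\Big(\big\{f\in C^1(\mathbb R^d,\mathbb R^d):\lambda(\{x:\det(Jf(x))=0\})=0\big\}\Big)=1 .$$ In particular, $$G\big(\Psi_\lambda^{-1}(\mathscr P_2^{\mathrm{ac}})\big)=1 .$$
   Context: Fix $d\in\mathbb N$. $\mathscr P_2$ is the set of Borel probability measures on $\mathbb R^d$ with finite second moment, and $\mathscr P_2^{\mathrm{ac}}\subset\mathscr P_2$ the subset of those that are absolutely continuous w.r.t. Lebesgue measure. Fix $\lambda\in\mathscr P_2^{\mathrm{ac}}$. $T_\lambda:=L^2(\mathbb R^d,\lambda;\mathbb R^d)$ with $\langle f,g\rangle_{T_\lambda}=\int f(x)^Tg(x)\,\lambda(dx)$, and $\Psi_\lambda:T_\lambda\to\mathscr P_2$, $\Psi_\lambda(f)=\lambda\circ f^{-1}$ (push-forward). $(A,\mathscr D(A))$ is a self-adjoint, strictly positive operator on $T_\lambda$ whose inverse $A^{-1}:T_\lambda\to T_\lambda$ is trace class; that $G$ has covariance operator $A^{-1}$ means $\int_{T_\lambda}\langle f_1,g\rangle_{T_\lambda}\langle f_2,g\rangle_{T_\lambda}G(dg)=\langle f_1,A^{-1}f_2\rangle_{T_\lambda}$ for $f_1,f_2\in T_\lambda$. For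 $f\in T_\lambda$, "$f\in C^1(\mathbb R^d,\mathbb R^d)$" means that the class $f$ has a continuously differentiable representative; $Jf(x)$ denotes its Jacobi matrix at $x$. *)

theory Defs
  imports "HOL-Probability.Probability"
begin

section \<open>Probability measures with finite second moment\<close>

definition P2 :: "(real ^ 'n) measure set" where
  "P2 = {\<mu>. prob_space \<mu> \<and> sets \<mu> = sets borel \<and> integrable \<mu> (\<lambda>x. (norm x)\<^sup>2)}"

definition P2_ac :: "(real ^ 'n) measure set" where
  "P2_ac = {\<mu> \<in> P2. absolutely_continuous lborel \<mu>}"


section \<open>The Hilbert space of square integrable vector fields\<close>

text \<open>
  An element of the Hilbert space is a class of Borel maps modulo almost everywhere equality,
  that is, a set of functions. As the space depends on the measure \<open>lam\<close>, it is a carrier set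
  rather than a type. The operations are given on classes through arbitrarily chosen
  representatives; their values do not depend on the choice.
\<close>

type_synonym 'n field_class = "(real ^ 'n \<Rightarrow> real ^ 'n) set"

definition L2_fun :: "(real ^ 'n) measure \<Rightarrow> (real ^ 'n \<Rightarrow> real ^ 'n) set" where
  "L2_fun lam = {f \<in> borel_measurable lam. integrable lam (\<lambda>x. (norm (f x))\<^sup>2)}"

definition L2_eq :: "(real ^ 'n) measure \<Rightarrow> ((real ^ 'n \<Rightarrow> real ^ 'n) \<times> (real ^ 'n \<Rightarrow> real ^ 'n)) set"
  where "L2_eq lam = {(f, h). f \<in> L2_fun lam \<and> h \<in> L2_fun lam \<and> (AE x in lam. f x = h x)}"

definition L2 :: "(real ^ 'n) measure \<Rightarrow> 'n field_class set" where
  "L2 lam = L2_fun lam // L2_eq lam"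

definition L2_class :: "(real ^ 'n) measure \<Rightarrow> (real ^ 'n \<Rightarrow> real ^ 'n) \<Rightarrow> 'n field_class" where
  "L2_class lam f = L2_eq lam `` {f}"

definition rep :: "'n field_class \<Rightarrow> real ^ 'n \<Rightarrow> real ^ 'n" where
  "rep F = (SOME f. f \<in> F)"

definition L2_zero :: "(real ^ 'n) measure \<Rightarrow> 'n field_class" where
  "L2_zero lam = L2_class lam (\<lambda>x. 0)"

definition L2_add :: "(real ^ 'n) measure \<Rightarrow> 'n field_class \<Rightarrow> 'n field_class \<Rightarrow> 'n field_class" where
  "L2_add lam F H = L2_class lam (\<lambda>x. rep F x + rep H x)"

definition L2_scale :: "(real ^ 'n) measure \<Rightarrow> real \<Rightarrow> 'n field_class \<Rightarrow> 'n field_class" where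
  "L2_scale lam c F = L2_class lam (\<lambda>x. c *\<^sub>R rep F x)"

definition L2_inner :: "(real ^ 'n) measure \<Rightarrow> 'n field_class \<Rightarrow> 'n field_class \<Rightarrow> real" where
  "L2_inner lam F H = (\<integral>x. rep F x \<bullet> rep H x \<partial>lam)"

definition L2_norm :: "(real ^ 'n) measure \<Rightarrow> 'n field_class \<Rightarrow> real" where
  "L2_norm lam F = sqrt (L2_inner lam F F)"

definition L2_dist :: "(real ^ 'n) measure \<Rightarrow> 'n field_class \<Rightarrow> 'n field_class \<Rightarrow> real" where
  "L2_dist lam F H = sqrt (\<integral>x. (norm (rep F x - rep H x))\<^sup>2 \<partial>lam)"

lemma equiv_L2_eq: "equiv (L2_fun lam) (L2_eq lam)"
proof (rule equivI)
  show "L2_eq lam \<subseteq> L2_fun lam \<times> L2_fun lam" by (auto simp: L2_eq_def)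
  show "refl_on (L2_fun lam) (L2_eq lam)" by (auto simp: refl_on_def L2_eq_def)
  show "sym (L2_eq lam)" by (auto simp: sym_def L2_eq_def)
  show "trans (L2_eq lam)" by (auto simp: trans_def L2_eq_def)
qed

lemma rep_in: assumes "F \<in> L2 lam" shows "rep F \<in> F"
proof -
  have "F \<noteq> {}"
    using assms in_quotient_imp_non_empty[OF equiv_L2_eq] by (auto simp: L2_def)
  then show ?thesis by (simp add: rep_def some_in_eq)
qed

lemma rep_L2_fun: assumes "F \<in> L2 lam" shows "rep F \<in> L2_fun lam"
  using assms rep_in[OF assms] in_quotient_imp_subset[OF equiv_L2_eq] by (auto simp: L2_def)

lemma L2_eq_iff:
  assumes "F \<in> L2 lam" "H \<in> L2 lam"
  shows "F = H \<longleftrightarrow> (AE x in lam. rep F x = rep H x)"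
proof -
  have "F = H \<longleftrightarrow> (rep F, rep H) \<in> L2_eq lam"
    using quotient_eq_iff[OF equiv_L2_eq] assms rep_in by (metis L2_def)
  then show ?thesis using assms by (simp add: L2_eq_def rep_L2_fun)
qed

lemma L2_dist_triangle_fun:
  fixes f g :: "real ^ 'n \<Rightarrow> real ^ 'n"
  assumes "f \<in> L2_fun lam" "g \<in> L2_fun lam"
  shows "integrable lam (\<lambda>x. (norm (f x + g x))\<^sup>2)"
    and "sqrt (\<integral>x. (norm (f x + g x))\<^sup>2 \<partial>lam)
      \<le> sqrt (\<integral>x. (norm (f x))\<^sup>2 \<partial>lam) + sqrt (\<integral>x. (norm (g x))\<^sup>2 \<partial>lam)"
proof -
  have [measurable]: "f \<in> borel_measurable lam" "g \<in> borel_measurable lam"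
    and F: "integrable lam (\<lambda>x. (norm (f x))\<^sup>2)" and G: "integrable lam (\<lambda>x. (norm (g x))\<^sup>2)"
    using assms by (auto simp: L2_fun_def)
  have fg: "integrable lam (\<lambda>x. norm (f x) * norm (g x))"
  proof (rule Bochner_Integration.integrable_bound[OF Bochner_Integration.integrable_add[OF F G]])
    have "norm (f x) * norm (g x) \<le> (norm (f x))\<^sup>2 + (norm (g x))\<^sup>2" for x
    proof -
      have "2 * (norm (f x) * norm (g x)) \<le> (norm (f x))\<^sup>2 + (norm (g x))\<^sup>2"
        using sum_squares_bound[of "norm (f x)" "norm (g x)"] by (simp add: mult.assoc)
      moreover have "0 \<le> norm (f x) * norm (g x)" by simp
      ultimately show ?thesis by linarith
    qed
    then show "AE x in lam. norm (norm (f x) * norm (g x)) \<le> norm ((norm (f x))\<^sup>2 + (norm (g x))\<^sup>2)"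
      by auto
  qed measurable
  have sq: "(norm (f x + g x))\<^sup>2 \<le> (norm (f x))\<^sup>2 + 2 * (norm (f x) * norm (g x)) + (norm (g x))\<^sup>2" for x
    using power_mono[OF norm_triangle_ineq[of "f x" "g x"], of 2] by (simp add: power2_sum)
  have I: "integrable lam (\<lambda>x. (norm (f x))\<^sup>2 + 2 * (norm (f x) * norm (g x)) + (norm (g x))\<^sup>2)"
    by (intro Bochner_Integration.integrable_add F G integrable_mult_right fg)
  show int: "integrable lam (\<lambda>x. (norm (f x + g x))\<^sup>2)"
    by (rule Bochner_Integration.integrable_bound[OF I]) (use sq in \<open>auto intro: order_trans[OF sq]\<close>)
  define a where "a = (\<integral>x. (norm (f x))\<^sup>2 \<partial>lam)"
  define b where "b = (\<integral>x. (norm (g x))\<^sup>2 \<partial>lam)"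
  define c where "c = (\<integral>x. norm (f x) * norm (g x) \<partial>lam)"
  have nn: "0 \<le> a" "0 \<le> b" "0 \<le> c" by (auto simp: a_def b_def c_def)
  have "(\<integral>\<^sup>+x. ennreal (norm (f x)) * ennreal (norm (g x)) \<partial>lam)\<^sup>2
      \<le> (\<integral>\<^sup>+x. (ennreal (norm (f x)))\<^sup>2 \<partial>lam) * (\<integral>\<^sup>+x. (ennreal (norm (g x)))\<^sup>2 \<partial>lam)"
    by (rule Cauchy_Schwarz_nn_integral) auto
  then have "(ennreal c)\<^sup>2 \<le> ennreal a * ennreal b"
    unfolding a_def b_def c_def
    by (simp add: ennreal_mult[symmetric] ennreal_power nn_integral_eq_integral[OF fg]
        nn_integral_eq_integral[OF F] nn_integral_eq_integral[OF G])
  then have "c\<^sup>2 \<le> a * b"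
    using nn by (simp add: ennreal_power ennreal_mult[symmetric])
  then have "c \<le> sqrt a * sqrt b"
    using nn by (simp add: real_le_rsqrt real_sqrt_mult[symmetric])
  moreover have "(\<integral>x. (norm (f x + g x))\<^sup>2 \<partial>lam) \<le> a + 2 * c + b"
    using integral_mono[OF int I sq] F G fg by (simp add: a_def b_def c_def)
  ultimately have "(\<integral>x. (norm (f x + g x))\<^sup>2 \<partial>lam) \<le> (sqrt a + sqrt b)\<^sup>2"
    using nn by (simp add: power2_sum)
  then show "sqrt (\<integral>x. (norm (f x + g x))\<^sup>2 \<partial>lam) \<le> sqrt (\<integral>x. (norm (f x))\<^sup>2 \<partial>lam) + sqrt (\<integral>x. (norm (g x))\<^sup>2 \<partial>lam)"
    using nn by (simp add: real_le_lsqrt a_def b_def)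
qed

lemma L2_fun_diff:
  assumes "f \<in> L2_fun lam" "g \<in> L2_fun lam"
  shows "(\<lambda>x. f x - g x) \<in> L2_fun lam"
proof -
  have "(\<lambda>x. - g x) \<in> L2_fun lam"
    using assms(2) by (auto simp: L2_fun_def)
  from L2_dist_triangle_fun(1)[OF assms(1) this] show ?thesis
    using assms by (auto simp: L2_fun_def)
qed

lemma Metric_space_L2: "Metric_space (L2 lam) (L2_dist lam)"
proof
  fix F H K :: "'a field_class"
  show "0 \<le> L2_dist lam F H" by (simp add: L2_dist_def)
  show "L2_dist lam F H = L2_dist lam H F" by (simp add: L2_dist_def norm_minus_commute)
  assume F: "F \<in> L2 lam" and H: "H \<in> L2 lam"
  have d: "(\<lambda>x. rep F x - rep H x) \<in> L2_fun lam"
    using L2_fun_diff[OF rep_L2_fun[OF F] rep_L2_fun[OF H]] .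
  then have "L2_dist lam F H = 0 \<longleftrightarrow> (AE x in lam. (norm (rep F x - rep H x))\<^sup>2 = 0)"
    unfolding L2_dist_def L2_fun_def
    by (simp add: integral_nonneg_eq_0_iff_AE[of lam "\<lambda>x. (norm (rep F x - rep H x))\<^sup>2"])
  then show "L2_dist lam F H = 0 \<longleftrightarrow> F = H"
    by (simp add: L2_eq_iff[OF F H])
  assume K: "K \<in> L2 lam"
  show "L2_dist lam F K \<le> L2_dist lam F H + L2_dist lam H K"
    using L2_dist_triangle_fun(2)[OF d L2_fun_diff[OF rep_L2_fun[OF H] rep_L2_fun[OF K]]]
    by (simp add: L2_dist_def)
qed

definition L2_topology :: "(real ^ 'n) measure \<Rightarrow> 'n field_class topology" where
  "L2_topology lam = Metric_space.mtopology (L2 lam) (L2_dist lam)"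

definition L2_borel :: "(real ^ 'n) measure \<Rightarrow> 'n field_class measure" where
  "L2_borel lam = sigma (L2 lam) {U. openin (L2_topology lam) U}"

definition push :: "(real ^ 'n) measure \<Rightarrow> 'n field_class \<Rightarrow> (real ^ 'n) measure" where
  "push lam F = distr lam borel (rep F)"


section \<open>Operators\<close>

text \<open>An unbounded operator is a pair of a domain \<open>D\<close> and a map \<open>A\<close>, whose values outside
  \<open>D\<close> are irrelevant.\<close>

definition L2_subspace :: "(real ^ 'n) measure \<Rightarrow> 'n field_class set \<Rightarrow> bool" where
  "L2_subspace lam D \<longleftrightarrow> D \<subseteq> L2 lam \<and> L2_zero lam \<in> D \<and>
     (\<forall>F\<in>D. \<forall>H\<in>D. L2_add lam F H \<in> D) \<and> (\<forall>c. \<forall>F\<in>D. L2_scale lam c F \<in> D)"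

definition L2_operator ::
  "(real ^ 'n) measure \<Rightarrow> 'n field_class set \<Rightarrow> ('n field_class \<Rightarrow> 'n field_class) \<Rightarrow> bool" where
  "L2_operator lam D A \<longleftrightarrow> L2_subspace lam D \<and> A ` D \<subseteq> L2 lam \<and>
     (\<forall>F\<in>D. \<forall>H\<in>D. A (L2_add lam F H) = L2_add lam (A F) (A H)) \<and>
     (\<forall>c. \<forall>F\<in>D. A (L2_scale lam c F) = L2_scale lam c (A F))"

definition L2_bounded_operator ::
  "(real ^ 'n) measure \<Rightarrow> ('n field_class \<Rightarrow> 'n field_class) \<Rightarrow> bool" where
  "L2_bounded_operator lam K \<longleftrightarrow> L2_operator lam (L2 lam) K \<and>
     (\<exists>C. \<forall>F\<in>L2 lam. L2_norm lam (K F) \<le> C * L2_norm lam F)"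

text \<open>The adjoint is represented by its graph.\<close>

definition L2_adjoint_graph ::
  "(real ^ 'n) measure \<Rightarrow> 'n field_class set \<Rightarrow> ('n field_class \<Rightarrow> 'n field_class) \<Rightarrow>
    ('n field_class \<times> 'n field_class) set" where
  "L2_adjoint_graph lam D A =
     {(H, K). H \<in> L2 lam \<and> K \<in> L2 lam \<and> (\<forall>F\<in>D. L2_inner lam (A F) H = L2_inner lam F K)}"

definition L2_self_adjoint ::
  "(real ^ 'n) measure \<Rightarrow> 'n field_class set \<Rightarrow> ('n field_class \<Rightarrow> 'n field_class) \<Rightarrow> bool" where
  "L2_self_adjoint lam D A \<longleftrightarrow> L2_operator lam D A \<and> L2_topology lam closure_of D = L2 lam \<and>
     L2_adjoint_graph lam D A = (\<lambda>F. (F, A F)) ` D"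

definition L2_strictly_positive ::
  "(real ^ 'n) measure \<Rightarrow> 'n field_class set \<Rightarrow> ('n field_class \<Rightarrow> 'n field_class) \<Rightarrow> bool" where
  "L2_strictly_positive lam D A \<longleftrightarrow> (\<forall>F\<in>D. F \<noteq> L2_zero lam \<longrightarrow> L2_inner lam F (A F) > 0)"

definition L2_orthonormal_basis :: "(real ^ 'n) measure \<Rightarrow> 'n field_class set \<Rightarrow> bool" where
  "L2_orthonormal_basis lam B \<longleftrightarrow> B \<subseteq> L2 lam \<and>
     (\<forall>F\<in>B. \<forall>H\<in>B. L2_inner lam F H = (if F = H then 1 else 0)) \<and>
     (\<forall>F\<in>L2 lam. (\<forall>H\<in>B. L2_inner lam F H = 0) \<longrightarrow> F = L2_zero lam)"

text \<open>\<open>P = \<bar>K\<bar>\<close>: the operator \<open>P\<close> is the nonnegative self-adjoint square root of \<open>K\<^sup>* K\<close>.\<close>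

definition L2_absolute_value ::
  "(real ^ 'n) measure \<Rightarrow> ('n field_class \<Rightarrow> 'n field_class) \<Rightarrow>
    ('n field_class \<Rightarrow> 'n field_class) \<Rightarrow> bool" where
  "L2_absolute_value lam P K \<longleftrightarrow> L2_bounded_operator lam P \<and> L2_self_adjoint lam (L2 lam) P \<and>
     (\<forall>F\<in>L2 lam. L2_inner lam F (P F) \<ge> 0) \<and>
     (\<forall>F\<in>L2 lam. \<forall>H\<in>L2 lam. L2_inner lam F (P (P H)) = L2_inner lam (K F) (K H))"

text \<open>The trace of \<open>\<bar>K\<bar>\<close> is finite; it does not depend on the orthonormal basis.\<close>

definition L2_trace_class ::
  "(real ^ 'n) measure \<Rightarrow> ('n field_class \<Rightarrow> 'n field_class) \<Rightarrow> bool" where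
  "L2_trace_class lam K \<longleftrightarrow> L2_bounded_operator lam K \<and>
     (\<exists>P B. L2_absolute_value lam P K \<and> L2_orthonormal_basis lam B \<and>
        (\<lambda>F. L2_inner lam F (P F)) summable_on B)"

definition L2_eigenvector ::
  "(real ^ 'n) measure \<Rightarrow> 'n field_class set \<Rightarrow> ('n field_class \<Rightarrow> 'n field_class) \<Rightarrow>
    'n field_class \<Rightarrow> bool" where
  "L2_eigenvector lam D A F \<longleftrightarrow> F \<in> D \<and> F \<noteq> L2_zero lam \<and> (\<exists>c. A F = L2_scale lam c F)"


section \<open>Gaussian measures\<close>

text \<open>Point masses count as normal distributions with variance zero.\<close>

definition normal_law :: "real \<Rightarrow> real \<Rightarrow> real measure" where
  "normal_law m s = (if s = 0 then return borel m else density lborel (normal_density m s))"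

definition L2_gaussian :: "(real ^ 'n) measure \<Rightarrow> 'n field_class measure \<Rightarrow> bool" where
  "L2_gaussian lam G \<longleftrightarrow> prob_space G \<and> sets G = sets (L2_borel lam) \<and>
     (\<forall>F\<in>L2 lam. \<exists>m. \<exists>s\<ge>0. distr G borel (L2_inner lam F) = normal_law m s)"

definition L2_centered :: "(real ^ 'n) measure \<Rightarrow> 'n field_class measure \<Rightarrow> bool" where
  "L2_centered lam G \<longleftrightarrow> (\<forall>F\<in>L2 lam. has_bochner_integral G (L2_inner lam F) 0)"

definition L2_covariance ::
  "(real ^ 'n) measure \<Rightarrow> 'n field_class measure \<Rightarrow> ('n field_class \<Rightarrow> 'n field_class) \<Rightarrow> bool" where
  "L2_covariance lam G Q \<longleftrightarrow> (\<forall>F1\<in>L2 lam. \<forall>F2\<in>L2 lam.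
     has_bochner_integral G (\<lambda>H. L2_inner lam F1 H * L2_inner lam F2 H) (L2_inner lam F1 (Q F2)))"


section \<open>Continuously differentiable classes\<close>

definition C1_map :: "(real ^ 'n \<Rightarrow> real ^ 'n) \<Rightarrow> bool" where
  "C1_map f \<longleftrightarrow> (\<forall>x. f differentiable (at x)) \<and> continuous_on UNIV (\<lambda>x. jacobian f (at x))"

definition L2_C1 :: "(real ^ 'n) measure \<Rightarrow> 'n field_class set" where
  "L2_C1 lam = {F \<in> L2 lam. \<exists>f\<in>F. C1_map f}"

text \<open>If \<open>lam\<close> is absolutely continuous, two continuously differentiable representatives of one
  class have the same Jacobi matrix \<open>lam\<close>-almost everywhere, so that the condition does not
  depend on the representative.\<close>

definition L2_C1_nondegenerate :: "(real ^ 'n) measure \<Rightarrow> 'n field_class set" where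
  "L2_C1_nondegenerate lam = {F \<in> L2 lam. \<exists>f\<in>F. C1_map f \<and>
     emeasure lam {x. det (jacobian f (at x)) = 0} = 0}"

end

theory Submission
  imports Defs
begin

text \<open>
  Write a sample as \<open>F = \<xi> g + R\<close>, where \<open>\<xi>\<close> is the coefficient of \<open>F\<close> along the eigenvector \<open>g\<close>.
  As \<open>g\<close> is an eigenvector of the covariance, \<open>\<xi>\<close> is a nondegenerate centered normal variable that is
  independent of \<open>R\<close>. For two continuously differentiable fields \<open>R\<close> and \<open>g\<close> and a point \<open>x\<close> with
  \<open>det (Jg(x)) \<noteq> 0\<close>, the polynomial \<open>t \<mapsto> det (JR(x) + t Jg(x))\<close> is not zero and has finitely many
  roots. By Fubini, for almost every \<open>t\<close> the field \<open>R + t g\<close> is nondegenerate at almost every \<open>x\<close>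
  (\<open>AE_nondegenerate_on_line\<close>), and integrating over \<open>\<xi>\<close> and then over \<open>R\<close> gives the claim.

  Independence enters as an invariance of the law: replacing \<open>\<xi>\<close> by a fresh normal variable \<open>t\<close> with
  the same variance does not change \<open>G\<close> (\<open>distr_resample\<close>). The Fourier transform of the
  resampled law is computed from the one-dimensional marginals of \<open>G\<close> alone, since pairing \<open>R\<close> with
  a vector amounts to pairing \<open>F\<close> with another one. That equal Fourier transforms force equal
  measures (\<open>L2_measure_eqI_fourier\<close>) needs two facts: the Hilbert space is separable, so that
  its Borel sets are generated by the cylinder sets (\<open>sets_L2_borel_eq_cylinders\<close>), and the values on
  cylinder sets can be recovered one coordinate at a time from the uniqueness theorem on the line
  (\<open>fourier_restrict\<close>).

  Both sets in the conclusion have to be shown measurable. For continuously differentiable \<open>f\<close> the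
  push-forward is absolutely continuous if and only if \<open>det (Jf)\<close> vanishes almost nowhere
  (\<open>C1_map_push_ac_iff\<close>): one direction is Sard's lemma, the other holds because \<open>f\<close> has locally
  Lipschitz inverses off the critical points. Hence the first set is the intersection of the second
  one with the set of continuously differentiable classes, which is measurable because it has
  measure one. The second set is Borel because absolute continuity is an \<open>\<epsilon>\<close>-\<open>\<delta>\<close> condition on
  countably many open sets (\<open>absolutely_continuous_iff_open_family\<close>), and because \<open>F \<mapsto> \<lambda>(F \<in> U)\<close> is
  lower semicontinuous for open \<open>U\<close> (\<open>openin_push_greater\<close>).
\<close>


section \<open>Critical points and images of absolutely continuous measures\<close>

text \<open>
  The lemma \<open>baby_Sard\<close> concerns coordinates indexed by a wellorder. This copy of a finite type
  carries an arbitrary one, so that the lemma can be transported along the relabelling of coordinates.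
\<close>

typedef 'a wo = "UNIV :: 'a set" morphisms unwo wo by simp

instance wo :: (finite) finite
proof
  have "(UNIV :: 'a wo set) = wo ` UNIV" by (metis unwo_inverse surjI)
  then show "finite (UNIV :: 'a wo set)" using finite_imageI[OF finite_class.finite_UNIV, of wo] by metis
qed

instantiation wo :: (finite) wellorder
begin

definition less_eq_wo :: "'a wo \<Rightarrow> 'a wo \<Rightarrow> bool" where
  "x \<le> y \<longleftrightarrow> to_nat_on UNIV (unwo x) \<le> to_nat_on UNIV (unwo y)"

definition less_wo :: "'a wo \<Rightarrow> 'a wo \<Rightarrow> bool" where
  "x < y \<longleftrightarrow> to_nat_on UNIV (unwo x) < to_nat_on UNIV (unwo y)"

instance
proof
  have inj: "inj (to_nat_on (UNIV :: 'a set))" by (rule inj_on_to_nat_on) (simp add: countable_finite)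
  show "x = y" if "x \<le> y" "y \<le> x" for x y :: "'a wo"
  proof -
    have "to_nat_on UNIV (unwo x) = to_nat_on UNIV (unwo y)"
      using that by (simp add: less_eq_wo_def)
    then show ?thesis using inj by (simp add: inj_eq unwo_inject)
  qed
  show "P a" if "\<And>x. (\<And>y. y < x \<Longrightarrow> P y) \<Longrightarrow> P x" for P and a :: "'a wo"
    by (induction a rule: measure_induct_rule[of "\<lambda>x. to_nat_on UNIV (unwo x)"])
      (use that in \<open>auto simp: less_wo_def\<close>)
qed (auto simp: less_eq_wo_def less_wo_def)

end

lemma negligible_image_of_critical_points:
  fixes f :: "real ^ 'n \<Rightarrow> real ^ 'n"
  assumes der: "\<And>x. x \<in> E \<Longrightarrow> (f has_derivative f' x) (at x)"
    and crit: "\<And>x. x \<in> E \<Longrightarrow> \<not> inj (f' x)"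
  shows "negligible (f ` E)"
proof -
  define T :: "real ^ 'n \<Rightarrow> real ^ 'n wo" where "T x = (\<chi> i. x $ unwo i)" for x
  define S :: "real ^ 'n wo \<Rightarrow> real ^ 'n" where "S y = (\<chi> i. y $ wo i)" for y
  have ST [simp]: "S (T x) = x" for x by (simp add: S_def T_def wo_inverse vec_eq_iff)
  have TS [simp]: "T (S x) = x" for x by (simp add: S_def T_def unwo_inverse vec_eq_iff)
  have lin: "linear T" "linear S"
    by (auto intro!: linearI simp: S_def T_def vec_eq_iff)
  then have bl: "bounded_linear T" "bounded_linear S" by (simp_all add: linear_conv_bounded_linear)
  define g where "g = (\<lambda>y. T (f (S y)))"
  define g' where "g' = (\<lambda>y h. T (f' (S y) (S h)))"
  have neg: "negligible (g ` (T ` E))"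
  proof (rule baby_Sard)
    fix y assume "y \<in> T ` E"
    then have Sy: "S y \<in> E" by auto
    have "(g has_derivative g' y) (at y)"
      unfolding g_def g'_def
      using has_derivative_compose[OF bounded_linear_imp_has_derivative[OF bl(2)] der[OF Sy]]
      by (rule bounded_linear.has_derivative[OF bl(1)])
    then show d: "(g has_derivative g' y) (at y within T ` E)" by (rule has_derivative_at_withinI)
    have l: "linear (g' y)" using d by (rule has_derivative_linear)
    have "\<not> inj (g' y)"
    proof
      assume i: "inj (g' y)"
      have "inj (f' (S y))"
      proof (rule injI)
        fix a b assume "f' (S y) a = f' (S y) b"
        then have "g' y (T a) = g' y (T b)" by (simp add: g'_def)
        then have "T a = T b" using i by (simp add: inj_eq)
        then show "a = b" by (metis ST)
      qed
      then show False using crit[OF Sy] by simp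
    qed
    moreover have "(*v) (matrix (g' y)) = g' y" using l by (simp add: fun_eq_iff)
    ultimately show "rank (matrix (g' y)) < CARD('n wo)" by (simp add: less_rank_noninjective)
  qed simp
  have "card (UNIV :: 'n wo set) = CARD('n)"
    by (rule bij_betw_same_card[of unwo]) (metis bij_betw_def injI surjI unwo_inject wo_inverse UNIV_I)
  then have "negligible (S ` g ` T ` E)"
    by (intro negligible_differentiable_image_negligible neg)
      (auto intro: linear_imp_differentiable_on lin)
  then show ?thesis by (simp add: image_image g_def)
qed

text \<open>
  Where the derivative is injective, \<open>f\<close> stretches small distances by at least a factor \<open>1 / k\<close> for
  some natural number \<open>k\<close>. The set of points that admit a given \<open>k\<close> on the scale \<open>1 / k\<close> is
  covered by pieces on which \<open>f\<close> has a Lipschitz inverse, and Lipschitz maps preserve null sets.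
\<close>

lemma negligible_preimage_of_negligible:
  fixes f :: "real ^ 'n \<Rightarrow> real ^ 'n"
  assumes der: "\<And>x. x \<in> E \<Longrightarrow> (f has_derivative f' x) (at x)"
    and inj: "\<And>x. x \<in> E \<Longrightarrow> inj (f' x)"
    and neg: "negligible (f ` E)"
  shows "negligible E"
proof -
  define P where "P k = {x \<in> E. \<forall>y. norm (y - x) < 1 / real (Suc k) \<longrightarrow>
      norm (y - x) \<le> real (Suc k) * norm (f y - f x)}" for k
  have "x \<in> (\<Union>k. P k)" if x: "x \<in> E" for x
  proof -
    obtain B where B: "B > 0" "\<And>h. B * norm h \<le> norm (f' x h)"
      using linear_inj_bounded_below_pos[OF has_derivative_linear[OF der[OF x]] inj[OF x]] by blast
    obtain d where d: "d > 0"
      "\<And>y. norm (y - x) < d \<Longrightarrow> norm (f y - f x - f' x (y - x)) \<le> B / 2 * norm (y - x)"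
      using der[OF x] B(1) unfolding has_derivative_at_alt
      by (metis half_gt_zero_iff)
    \<comment> \<open>The bound \<open>1 / d\<close> makes the scale fine enough for the estimate above, and \<open>2 / B\<close> is the
      Lipschitz constant of the inverse once half of the stretching is spent on the remainder.\<close>
    obtain k where k: "real (Suc k) > max (1 / d) (2 / B)"
      by (metis reals_Archimedean2 less_SucI of_nat_less_iff order.strict_trans lessI)
    have kd: "1 / real (Suc k) < d" using k d(1) by (simp add: field_simps)
    have "norm (y - x) \<le> real (Suc k) * norm (f y - f x)" if y: "norm (y - x) < 1 / real (Suc k)" for y
    proof -
      have a: "norm (f y - f x - f' x (y - x)) \<le> B / 2 * norm (y - x)"
        using d(2) y kd by simp
      have "norm (f' x (y - x)) \<le> norm (f y - f x) + norm (f y - f x - f' x (y - x))"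
        by (metis norm_triangle_sub norm_minus_commute add.commute)
      then have "B / 2 * norm (y - x) \<le> norm (f y - f x)"
        using a B(2)[of "y - x"] by linarith
      then have "norm (y - x) \<le> (2 / B) * norm (f y - f x)"
        using B(1) by (simp add: field_simps)
      also have "\<dots> \<le> real (Suc k) * norm (f y - f x)"
        using k by (intro mult_right_mono) auto
      finally show ?thesis .
    qed
    then show ?thesis using x unfolding P_def by blast
  qed
  then have E: "E = (\<Union>k. P k)" by (auto simp: P_def)
  have "negligible (P k)" for k
    unfolding locally_negligible_alt[of "P k"]
  proof
    fix x0 assume x0: "x0 \<in> P k"
    define V where "V = P k \<inter> ball x0 (1 / (2 * real (Suc k)))"
    have close: "norm (y - x) \<le> real (Suc k) * norm (f y - f x)" if "x \<in> V" "y \<in> V" for x y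
    proof -
      have "dist y x < 1 / (2 * real (Suc k)) + 1 / (2 * real (Suc k))"
        using that unfolding V_def by (intro dist_triangle_less_add[of y x0]) (auto simp: dist_commute)
      also have "\<dots> = 1 / real (Suc k)" by (simp add: field_simps)
      finally show ?thesis using that by (auto simp: V_def P_def dist_norm)
    qed
    have injV: "inj_on f V"
    proof (rule inj_onI)
      fix x y assume "x \<in> V" "y \<in> V" "f x = f y"
      then show "x = y" using close[of x y] by simp
    qed
    have "negligible (inv_into V f ` f ` V)"
    proof (rule negligible_locally_Lipschitz_image)
      show "negligible (f ` V)"
        by (rule negligible_subset[OF neg]) (auto simp: V_def P_def)
      show "\<exists>T B. open T \<and> u \<in> T \<and> (\<forall>v\<in>f ` V \<inter> T. norm (inv_into V f v - inv_into V f u) \<le> B * norm (v - u))"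
        if "u \<in> f ` V" for u
        using that close injV by (intro exI[of _ UNIV] exI[of _ "real (Suc k)"]) auto
    qed simp
    then have "negligible V" using injV by simp
    moreover have "openin (top_of_set (P k)) V"
      unfolding V_def by (rule openin_open_Int) simp
    moreover have "x0 \<in> V" using x0 by (simp add: V_def)
    ultimately show "\<exists>U. openin (top_of_set (P k)) U \<and> x0 \<in> U \<and> negligible U" by blast
  qed
  then show ?thesis unfolding E by (intro negligible_countable_Union) auto
qed

lemma C1_map_has_derivative:
  assumes "C1_map f"
  shows "(f has_derivative (*v) (jacobian f (at x))) (at x)"
  using assms jacobian_works[of f "at x"] by (simp add: C1_map_def)

lemma C1_map_measurable: "C1_map f \<Longrightarrow> f \<in> borel_measurable borel"
  by (intro borel_measurable_continuous_onI differentiable_imp_continuous_on)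
    (auto simp: C1_map_def differentiable_on_def differentiable_at_withinI)

lemma closed_critical_points:
  assumes "C1_map f"
  shows "closed {x. det (jacobian f (at x)) = 0}"
proof -
  have "continuous_on UNIV (\<lambda>x. det (jacobian f (at x)))"
    unfolding det_def using assms
    by (intro continuous_intros) (auto simp: C1_map_def intro!: continuous_on_component)
  then show ?thesis by (rule closed_Collect_eq[OF _ continuous_on_const])
qed

lemma inj_jacobian_iff_det: "inj ((*v) (M :: real ^ 'n ^ 'n)) \<longleftrightarrow> det M \<noteq> 0"
  using det_eq_0_rank[of M] less_rank_noninjective[of M] by auto

text \<open>
  If the critical points had positive measure, their image would be a null set by Sard's lemma while
  the preimage of this image is not null. Conversely a null set has a preimage that is null off the
  critical points. The map \<open>h\<close> is an arbitrary representative of the class of \<open>f\<close>.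
\<close>

lemma C1_map_push_ac_iff:
  fixes lam :: "(real ^ 'n) measure"
  assumes ac: "absolutely_continuous lborel lam" and sets: "sets lam = sets borel"
    and f: "C1_map f" and h: "h \<in> borel_measurable lam" and eq: "AE x in lam. h x = f x"
  shows "absolutely_continuous lborel (distr lam borel h) \<longleftrightarrow>
    emeasure lam {x. det (jacobian f (at x)) = 0} = 0" (is "?L \<longleftrightarrow> emeasure lam ?Z = 0")
proof -
  have sp: "space lam = UNIV" using sets_eq_imp_space_eq[OF sets] by simp
  have fm: "f \<in> borel_measurable lam"
    using C1_map_measurable[OF f] by (simp add: measurable_cong_sets[OF sets refl])
  have distr: "distr lam borel h = distr lam borel f"
    by (rule distr_cong_AE) (use eq h fm in auto)
  have Z: "?Z \<in> sets lam" using closed_critical_points[OF f] sets by auto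
  have null: "N \<in> null_sets lam" if "N \<in> sets borel" "negligible N" for N
  proof -
    have "N \<in> null_sets lebesgue" using that(2) negligible_iff_null_sets by blast
    then have "N \<in> null_sets lborel" using that(1) by (auto simp: null_sets_def)
    then show ?thesis using ac by (auto simp: absolutely_continuous_def)
  qed
  show ?thesis
  proof
    assume L: ?L
    have "negligible (f ` ?Z)"
      by (rule negligible_image_of_critical_points[of _ _ "\<lambda>x. (*v) (jacobian f (at x))"])
        (auto intro: C1_map_has_derivative[OF f] simp: inj_jacobian_iff_det)
    then have "f ` ?Z \<in> null_sets lebesgue" using negligible_iff_null_sets by blast
    then obtain N where N: "N \<in> null_sets lborel" "f ` ?Z \<subseteq> N"
      by (meson null_sets_completion_iff2)
    then have "N \<in> null_sets (distr lam borel f)"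
      using L distr by (auto simp: absolutely_continuous_def)
    then have "emeasure lam (f -` N) = 0" using fm sp emeasure_distr[OF fm, of N] N by (auto simp: null_sets_def)
    moreover have "f -` N \<in> sets lam" using N measurable_sets[OF fm, of N] sp by auto
    moreover have "?Z \<subseteq> f -` N" using N by auto
    ultimately show "emeasure lam ?Z = 0" by (metis emeasure_eq_0)
  next
    assume Z0: "emeasure lam ?Z = 0"
    show ?L unfolding distr absolutely_continuous_def
    proof
      fix N :: "(real ^ 'n) set" assume N: "N \<in> null_sets lborel"
      have Nb: "N \<in> sets borel" using N by auto
      have pre: "f -` N \<in> sets borel"
        using measurable_sets[OF C1_map_measurable[OF f] Nb] by simp
      have "negligible (f -` N - ?Z)"
      proof (rule negligible_preimage_of_negligible[of _ _ "\<lambda>x. (*v) (jacobian f (at x))"])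
        have "negligible N" using N negligible_iff_null_sets null_sets_completionI by blast
        then show "negligible (f ` (f -` N - ?Z))" by (rule negligible_subset) auto
      qed (auto intro: C1_map_has_derivative[OF f] simp: inj_jacobian_iff_det)
      then have "f -` N - ?Z \<in> null_sets lam" using pre Z sets by (intro null) auto
      moreover have "?Z \<in> null_sets lam" using Z Z0 by auto
      ultimately have "(f -` N - ?Z) \<union> ?Z \<in> null_sets lam" by (rule null_sets.Un)
      then have "f -` N \<in> null_sets lam"
        by (rule null_sets_subset) (use pre sets in auto)
      then show "N \<in> null_sets (distr lam borel f)"
        using Nb fm sp by (simp add: null_sets_distr_iff)
    qed
  qed
qed


section \<open>Singular matrices and degenerate fields on a line\<close>

lemma det_scaleR:
  fixes M :: "real ^ 'n ^ 'n"
  shows "det (c *\<^sub>R M) = c ^ CARD('n) * det M"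
  by (simp add: det_def prod.distrib sum_distrib_left algebra_simps)

text \<open>
  For \<open>t \<noteq> 0\<close> the determinant of \<open>M + t N\<close> is a power of \<open>t\<close> times the value at \<open>1 / t\<close> of the
  polynomial \<open>s \<mapsto> det (s M + N)\<close>. Passing to \<open>1 / t\<close> makes nonvanishing of the polynomial obvious: its
  value at \<open>0\<close> is \<open>det N\<close>.
\<close>

lemma finite_singular_on_line:
  fixes M N :: "real ^ 'n ^ 'n"
  assumes N: "det N \<noteq> 0"
  shows "finite {t. det (M + t *\<^sub>R N) = 0}"
proof -
  define p where "p = (\<Sum>\<sigma> | \<sigma> permutes (UNIV :: 'n set).
    smult (of_int (sign \<sigma>)) (\<Prod>i\<in>UNIV. [: N $ i $ \<sigma> i, M $ i $ \<sigma> i :]))"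
  have p: "poly p s = det (s *\<^sub>R M + N)" for s
    by (simp add: p_def det_def poly_sum poly_prod algebra_simps)
  have "poly p 0 \<noteq> 0" using N by (simp add: p)
  then have "p \<noteq> 0" by auto
  then have "finite (insert 0 (inverse ` {s. poly p s = 0}))"
    by (simp add: poly_roots_finite)
  moreover have "{t. det (M + t *\<^sub>R N) = 0} \<subseteq> insert 0 (inverse ` {s. poly p s = 0})"
  proof
    fix t assume t: "t \<in> {t. det (M + t *\<^sub>R N) = 0}"
    show "t \<in> insert 0 (inverse ` {s. poly p s = 0})"
    proof (cases "t = 0")
      case False
      then have "M + t *\<^sub>R N = t *\<^sub>R (inverse t *\<^sub>R M + N)"
        by (simp add: scaleR_right_distrib)
      then have "t ^ CARD('n) * poly p (inverse t) = 0"
        using t by (simp add: p det_scaleR)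
      then have "poly p (inverse t) = 0" using False by simp
      moreover have "t = inverse (inverse t)" by simp
      ultimately show ?thesis by blast
    qed simp
  qed
  ultimately show ?thesis by (rule finite_subset[rotated])
qed

lemma jacobian_add_scaleR:
  assumes "C1_map f" "C1_map g"
  shows "((\<lambda>x. f x + t *\<^sub>R g x) has_derivative
      (*v) (jacobian f (at x) + t *\<^sub>R jacobian g (at x))) (at x)"
    and "jacobian (\<lambda>x. f x + t *\<^sub>R g x) (at x) = jacobian f (at x) + t *\<^sub>R jacobian g (at x)"
proof -
  show d: "((\<lambda>x. f x + t *\<^sub>R g x) has_derivative
      (*v) (jacobian f (at x) + t *\<^sub>R jacobian g (at x))) (at x)"
  proof -
    have "((\<lambda>x. f x + t *\<^sub>R g x) has_derivative
        (\<lambda>h. jacobian f (at x) *v h + t *\<^sub>R (jacobian g (at x) *v h))) (at x)"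
      using assms jacobian_works[of f "at x"] jacobian_works[of g "at x"]
      by (auto simp: C1_map_def intro!: derivative_intros)
    moreover have "((*v) (jacobian f (at x) + t *\<^sub>R jacobian g (at x))) =
        (\<lambda>h. jacobian f (at x) *v h + t *\<^sub>R (jacobian g (at x) *v h))"
      by (simp add: fun_eq_iff matrix_vector_mult_def vec_eq_iff sum.distrib sum_distrib_left algebra_simps)
    ultimately show ?thesis by simp
  qed
  show "jacobian (\<lambda>x. f x + t *\<^sub>R g x) (at x) = jacobian f (at x) + t *\<^sub>R jacobian g (at x)"
    by (subst jacobian_def) (simp only: frechet_derivative_at[OF d, symmetric] matrix_of_matrix_vector_mul)
qed

lemma C1_map_add_scaleR:
  assumes "C1_map f" "C1_map g"
  shows "C1_map (\<lambda>x. f x + t *\<^sub>R g x)"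
  unfolding C1_map_def jacobian_add_scaleR(2)[OF assms]
proof (intro conjI allI)
  show "(\<lambda>x. f x + t *\<^sub>R g x) differentiable at x" for x
    using jacobian_add_scaleR(1)[OF assms] by (rule differentiableI)
  show "continuous_on UNIV (\<lambda>x. jacobian f (at x) + t *\<^sub>R jacobian g (at x))"
    using assms by (intro continuous_intros) (auto simp: C1_map_def)
qed

text \<open>
  For almost every \<open>x\<close> only finitely many \<open>t\<close> are bad; exchanging the two quantifiers is Fubini's
  theorem for the closed set of bad pairs.
\<close>

lemma AE_nondegenerate_on_line:
  fixes lam :: "(real ^ 'n) measure"
  assumes lam: "sigma_finite_measure lam" and sets [measurable_cong]: "sets lam = sets borel"
    and f: "C1_map f" and g: "C1_map g"
    and nondeg: "emeasure lam {x. det (jacobian g (at x)) = 0} = 0"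
  shows "AE t in lborel. emeasure lam {x. det (jacobian (\<lambda>x. f x + t *\<^sub>R g x) (at x)) = 0} = 0"
proof -
  let ?J = "\<lambda>t x. det (jacobian f (at x) + t *\<^sub>R jacobian g (at x))"
  interpret pair_sigma_finite lborel lam
    using lam by (intro pair_sigma_finite.intro) (auto intro: lborel.sigma_finite_measure_axioms)
  have sp: "space lam = UNIV" using sets_eq_imp_space_eq[OF sets] by simp
  have jac: "continuous_on UNIV (\<lambda>z :: real \<times> (real ^ 'n). jacobian h (at (snd z)))"
    if "C1_map h" for h :: "real ^ 'n \<Rightarrow> real ^ 'n"
    by (rule continuous_on_compose2[of UNIV "\<lambda>x. jacobian h (at x)"])
      (use that in \<open>auto simp: C1_map_def intro: continuous_intros\<close>)
  have "continuous_on UNIV (\<lambda>z :: real \<times> (real ^ 'n). ?J (fst z) (snd z))"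
    unfolding det_def by (intro continuous_intros jac f g)
  then have "(\<lambda>z :: real \<times> (real ^ 'n). ?J (fst z) (snd z)) \<in> borel_measurable (borel \<Otimes>\<^sub>M borel)"
    by (simp add: borel_prod borel_measurable_continuous_onI)
  then have meas: "(\<lambda>z. ?J (fst z) (snd z)) \<in> borel_measurable (lborel \<Otimes>\<^sub>M lam)"
    by (simp add: measurable_cong_sets[OF sets_pair_measure_cong[OF sets_lborel sets] refl])
  have "AE x in lam. det (jacobian g (at x)) \<noteq> 0"
  proof (rule AE_I')
    show "{x. det (jacobian g (at x)) = 0} \<in> null_sets lam"
      using nondeg sets closed_critical_points[OF g] by auto
  qed auto
  then have "AE x in lam. AE t in lborel. ?J t x \<noteq> 0"
  proof eventually_elim
    case (elim x)
    then have "finite {t. ?J t x = 0}" by (rule finite_singular_on_line)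
    then have "{t. ?J t x = 0} \<in> null_sets lborel" by (rule finite_imp_null_set_lborel)
    then show "AE t in lborel. ?J t x \<noteq> 0" by (rule AE_I') auto
  qed
  moreover have "{z \<in> space (lborel \<Otimes>\<^sub>M lam). ?J (fst z) (snd z) \<noteq> 0} \<in> sets (lborel \<Otimes>\<^sub>M lam)"
    using meas by measurable
  ultimately have "AE t in lborel. AE x in lam. ?J t x \<noteq> 0"
    using AE_commute[of "\<lambda>t x. ?J t x \<noteq> 0"] by blast
  then show ?thesis
  proof eventually_elim
    case (elim t)
    then obtain N where N: "{x. ?J t x = 0} \<subseteq> N" "emeasure lam N = 0" "N \<in> sets lam"
      using sp by (auto elim!: AE_E)
    then show "emeasure lam {x. det (jacobian (\<lambda>x. f x + t *\<^sub>R g x) (at x)) = 0} = 0"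
      by (simp add: jacobian_add_scaleR[OF f g]) (rule emeasure_eq_0)
  qed
qed


section \<open>Absolute continuity tested on countably many open sets\<close>

text \<open>
  Finite unions of members of a countable basis.
\<close>

lemma open_exhausting_family:
  obtains \<U> :: "'a::second_countable_topology set set"
  where "countable \<U>" "\<And>U. U \<in> \<U> \<Longrightarrow> open U"
    "\<And>V. open V \<Longrightarrow> \<exists>U. range U \<subseteq> \<U> \<and> incseq U \<and> (\<Union>n::nat. U n) = V"
proof -
  obtain B :: "'a set set" where B: "countable B" "topological_basis B"
    using ex_countable_basis by blast
  \<comment> \<open>The empty set is adjoined so that the members contained in a given open set can be enumerated
    even if that set is empty.\<close>
  let ?B = "insert {} B"
  let ?\<U> = "Union ` {S. finite S \<and> S \<subseteq> ?B}"
  have "countable ?\<U>" by (intro countable_image countable_Collect_finite_subset) (use B in simp)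
  moreover have "open U" if "U \<in> ?\<U>" for U
    using that topological_basis_open[OF B(2)] by auto
  moreover have "\<exists>U. range U \<subseteq> ?\<U> \<and> incseq U \<and> (\<Union>n::nat. U n) = V" if V: "open V" for V
  proof -
    define C where "C = {b \<in> ?B. b \<subseteq> V}"
    have "countable ?B" using B(1) by simp
    then have C: "countable C" by (rule countable_subset[rotated]) (auto simp: C_def)
    have Cne: "C \<noteq> {}" by (auto simp: C_def)
    have UC: "\<Union>C = V"
    proof (intro equalityI subsetI)
      fix y assume "y \<in> V"
      then obtain b where "b \<in> B" "y \<in> b" "b \<subseteq> V" by (rule topological_basisE[OF B(2) V])
      then show "y \<in> \<Union>C" unfolding C_def by blast
    qed (auto simp: C_def)
    let ?U = "\<lambda>n. \<Union>(from_nat_into C ` {..n})"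
    have mem: "from_nat_into C i \<in> C" for i using from_nat_into[OF Cne] .
    have "range ?U \<subseteq> ?\<U>"
    proof
      fix X assume "X \<in> range ?U"
      then obtain n where "X = \<Union>(from_nat_into C ` {..n})" by auto
      moreover have "from_nat_into C ` {..n} \<subseteq> ?B" using mem by (auto simp: C_def)
      ultimately show "X \<in> ?\<U>" by auto
    qed
    moreover have "incseq ?U" unfolding incseq_def by (intro allI impI Union_mono image_mono) simp
    moreover have "(\<Union>n. ?U n) = V"
    proof -
      have "(\<Union>n. ?U n) = \<Union>(range (from_nat_into C))" by auto
      then show ?thesis using range_from_nat_into[OF Cne C] UC by simp
    qed
    ultimately show ?thesis by (intro exI[of _ ?U]) blast
  qed
  ultimately show ?thesis using that[of ?\<U>] by blast
qed

text \<open>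
  Absolute continuity of a finite measure is uniform (a Borel-Cantelli argument), and the uniform
  statement passes from the family to all open sets by monotone limits and then to all null sets by
  outer regularity. For a countable family the right side involves only countably many values of \<open>\<mu>\<close>,
  which makes it a measurable condition on \<open>\<mu>\<close>.
\<close>

lemma absolutely_continuous_iff_open_family:
  fixes \<mu> :: "'a::euclidean_space measure"
  assumes \<mu>: "finite_measure \<mu>" and sets: "sets \<mu> = sets borel"
    and op: "\<And>U. U \<in> \<U> \<Longrightarrow> open U"
    and ex: "\<And>V. open V \<Longrightarrow> \<exists>U. range U \<subseteq> \<U> \<and> incseq U \<and> (\<Union>n::nat. U n) = V"
  shows "absolutely_continuous lborel \<mu> \<longleftrightarrow>
    (\<forall>k. \<exists>m. \<forall>U\<in>\<U>. emeasure lborel U \<le> ennreal ((1/2) ^ m) \<longrightarrow> measure \<mu> U \<le> 1 / real (Suc k))"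
    (is "?L \<longleftrightarrow> ?R")
proof -
  interpret \<mu>: finite_measure \<mu> by fact
  have sp: "space \<mu> = UNIV" using sets_eq_imp_space_eq[OF sets] by simp
  have 1: ?R if L: ?L
  proof (rule ccontr)
    assume "\<not> ?R"
    then obtain k where "\<forall>m. \<exists>U\<in>\<U>. emeasure lborel U \<le> ennreal ((1/2) ^ m) \<and> measure \<mu> U > 1 / real (Suc k)"
      by (auto simp: not_le)
    then obtain U where U: "\<And>m. U m \<in> \<U>" "\<And>m. emeasure lborel (U m) \<le> ennreal ((1/2) ^ m)"
      "\<And>m. measure \<mu> (U m) > 1 / real (Suc k)" by metis
    have Ub: "U m \<in> sets borel" for m using op[OF U(1)] by auto
    have "limsup U \<in> null_sets lborel"
    proof (rule borel_cantelli_limsup1)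
      show "emeasure lborel (U n) < \<infinity>" for n
        using U(2)[of n] by (simp add: ennreal_less_top order_le_less_trans)
      show "summable (\<lambda>n. measure lborel (U n))"
      proof (rule summable_comparison_test'[OF summable_geometric, of "1/2" 0])
        show "norm (measure lborel (U n)) \<le> (1/2) ^ n" for n
          using U(2)[of n] by (simp add: measure_def enn2real_leI)
      qed simp
    qed (use Ub in simp)
    then have "emeasure \<mu> (limsup U) = 0" using L by (auto simp: absolutely_continuous_def)
    then have m0: "measure \<mu> (limsup U) = 0" by (simp add: measure_def)
    define V where "V n = (\<Union>m\<in>{n..}. U m)" for n
    have "decseq V" unfolding decseq_def V_def by (intro allI impI UN_mono) auto
    then have "(\<lambda>n. measure \<mu> (V n)) \<longlonglongrightarrow> measure \<mu> (\<Inter>n. V n)"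
      by (rule \<mu>.finite_Lim_measure_decseq[rotated]) (use Ub sets in \<open>auto simp: V_def [abs_def]\<close>)
    moreover have "(\<Inter>n. V n) = limsup U" by (simp add: V_def limsup_INF_SUP)
    ultimately have "(\<lambda>n. measure \<mu> (V n)) \<longlonglongrightarrow> 0" using m0 by simp
    moreover have "measure \<mu> (V n) \<ge> 1 / real (Suc k)" for n
    proof -
      have "measure \<mu> (U n) \<le> measure \<mu> (V n)"
        by (rule \<mu>.finite_measure_mono) (use Ub sets in \<open>auto simp: V_def [abs_def]\<close>)
      then show ?thesis using U(3)[of n] by linarith
    qed
    ultimately have "1 / real (Suc k) \<le> 0" by (intro LIMSEQ_le_const) auto
    then show False by simp
  qed
  have 2: ?L if R: ?R
    unfolding absolutely_continuous_def
  proof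
    fix N :: "'a set" assume N: "N \<in> null_sets lborel"
    have Nl: "N \<in> sets lborel" using N by (rule null_setsD2)
    then have Nb: "N \<in> sets \<mu>" by (simp add: sets)
    have "measure \<mu> N \<le> 1 / real (Suc k)" for k
    proof -
      obtain m where m: "\<And>U. U \<in> \<U> \<Longrightarrow> emeasure lborel U \<le> ennreal ((1/2) ^ m) \<Longrightarrow> measure \<mu> U \<le> 1 / real (Suc k)"
        using R by blast
      obtain V where V: "open V" "N \<subseteq> V" "emeasure lborel (V - N) < ennreal ((1/2) ^ m)"
        using outer_regular_lborel[of N "(1/2) ^ m"] Nl by (auto simp: sets_lborel)
      have lV: "emeasure lborel V \<le> ennreal ((1/2) ^ m)"
      proof -
        have "emeasure lborel (V - N) = emeasure lborel V"
          using N V(1) by (intro emeasure_Diff_null_set) auto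
        then show ?thesis using V(3) by simp
      qed
      obtain U where U: "range U \<subseteq> \<U>" "incseq U" "(\<Union>n::nat. U n) = V" using ex[OF V(1)] by blast
      have Ub: "U n \<in> sets borel" for n using op U(1) by (meson borel_open range_subsetD)
      have "measure \<mu> (U n) \<le> 1 / real (Suc k)" for n
      proof (rule m)
        show "U n \<in> \<U>" using U(1) by auto
        have "emeasure lborel (U n) \<le> emeasure lborel V"
        proof (rule emeasure_mono)
          show "U n \<subseteq> V" using U(3) by blast
          show "V \<in> sets lborel" using V(1) by simp
        qed
        then show "emeasure lborel (U n) \<le> ennreal ((1/2) ^ m)" using lV by simp
      qed
      moreover have "(\<lambda>n. measure \<mu> (U n)) \<longlonglongrightarrow> measure \<mu> V"
        using \<mu>.finite_Lim_measure_incseq[OF _ U(2)] Ub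
        unfolding U(3) sets by (simp add: image_subset_iff)
      ultimately have "measure \<mu> V \<le> 1 / real (Suc k)" by (intro LIMSEQ_le_const2) auto
      moreover have "measure \<mu> N \<le> measure \<mu> V"
        by (rule \<mu>.finite_measure_mono) (simp_all add: V sets)
      ultimately show ?thesis by simp
    qed
    moreover have "(\<lambda>k. 1 / real (Suc k)) \<longlonglongrightarrow> 0" by (rule LIMSEQ_Suc[OF lim_1_over_n])
    ultimately have "measure \<mu> N \<le> 0" by (intro LIMSEQ_le_const) auto
    then have "measure \<mu> N = 0" using measure_nonneg[of \<mu> N] by linarith
    then have "emeasure \<mu> N = 0" by (simp add: \<mu>.emeasure_eq_measure)
    then show "N \<in> null_sets \<mu>" using Nb by (rule null_setsI)
  qed
  show ?thesis by (rule iffI[OF 1 2])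
qed


section \<open>Classes and their representatives\<close>

lemma L2_class_in: "f \<in> L2_fun lam \<Longrightarrow> L2_class lam f \<in> L2 lam"
  by (simp add: L2_class_def L2_def quotientI)

lemma rep_L2_class:
  assumes "f \<in> L2_fun lam"
  shows "AE x in lam. rep (L2_class lam f) x = f x"
proof -
  have "(f, rep (L2_class lam f)) \<in> L2_eq lam"
    using rep_in[OF L2_class_in[OF assms]] by (simp add: L2_class_def)
  then show ?thesis by (auto simp: L2_eq_def)
qed

lemma L2_class_cong:
  assumes "f \<in> L2_fun lam" "h \<in> L2_fun lam" "AE x in lam. f x = h x"
  shows "L2_class lam f = L2_class lam h"
  unfolding L2_class_def using assms by (intro equiv_class_eq[OF equiv_L2_eq]) (simp add: L2_eq_def)

lemma L2_class_rep: "F \<in> L2 lam \<Longrightarrow> L2_class lam (rep F) = F"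
  using L2_eq_iff[OF L2_class_in[OF rep_L2_fun], of F lam F] rep_L2_class[OF rep_L2_fun, of F lam]
  by simp

lemma L2_representative:
  assumes "F \<in> L2 lam" "f \<in> F"
  shows "f \<in> L2_fun lam" "AE x in lam. rep F x = f x" "L2_class lam f = F"
proof -
  have e: "(rep F, f) \<in> L2_eq lam"
    using assms rep_in[OF assms(1)] quotient_eq_iff[OF equiv_L2_eq, of F lam F "rep F" f]
    by (simp add: L2_def)
  then show f: "f \<in> L2_fun lam" and "AE x in lam. rep F x = f x" by (auto simp: L2_eq_def)
  have "L2_class lam (rep F) = L2_class lam f"
    unfolding L2_class_def by (rule equiv_class_eq[OF equiv_L2_eq e])
  then show "L2_class lam f = F" using L2_class_rep[OF assms(1)] by simp
qed

lemma L2_fun_scale: "f \<in> L2_fun lam \<Longrightarrow> (\<lambda>x. c *\<^sub>R f x) \<in> L2_fun lam"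
  by (auto simp: L2_fun_def power_mult_distrib)

lemma L2_fun_add: "f \<in> L2_fun lam \<Longrightarrow> h \<in> L2_fun lam \<Longrightarrow> (\<lambda>x. f x + h x) \<in> L2_fun lam"
  using L2_dist_triangle_fun(1)[of f lam h] by (auto simp: L2_fun_def)

lemma L2_fun_zero: "(\<lambda>x. 0) \<in> L2_fun lam"
  by (simp add: L2_fun_def)

lemma integrable_inner_L2_fun:
  assumes "f \<in> L2_fun lam" "h \<in> L2_fun lam"
  shows "integrable lam (\<lambda>x. f x \<bullet> h x)"
proof -
  have [measurable]: "f \<in> borel_measurable lam" "h \<in> borel_measurable lam"
    using assms by (auto simp: L2_fun_def)
  have "integrable lam (\<lambda>x. ((norm (f x + h x))\<^sup>2 - (norm (f x))\<^sup>2 - (norm (h x))\<^sup>2) / 2)"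
    using L2_fun_add[OF assms] assms by (auto simp: L2_fun_def)
  moreover have "(\<lambda>x. ((norm (f x + h x))\<^sup>2 - (norm (f x))\<^sup>2 - (norm (h x))\<^sup>2) / 2) = (\<lambda>x. f x \<bullet> h x)"
    by (simp add: dot_norm fun_eq_iff)
  ultimately show ?thesis by simp
qed

lemma L2_inner_cong_AE:
  assumes "F \<in> L2 lam" "H \<in> L2 lam" "f \<in> L2_fun lam" "h \<in> L2_fun lam"
    "AE x in lam. rep F x = f x" "AE x in lam. rep H x = h x"
  shows "L2_inner lam F H = (\<integral>x. f x \<bullet> h x \<partial>lam)"
  unfolding L2_inner_def
proof (rule integral_cong_AE)
  show "(\<lambda>x. rep F x \<bullet> rep H x) \<in> borel_measurable lam" "(\<lambda>x. f x \<bullet> h x) \<in> borel_measurable lam"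
    using integrable_inner_L2_fun assms rep_L2_fun by blast+
  show "AE x in lam. rep F x \<bullet> rep H x = f x \<bullet> h x"
    using assms(5,6) by eventually_elim simp
qed

lemma L2_inner_class:
  assumes "f \<in> L2_fun lam" "h \<in> L2_fun lam"
  shows "L2_inner lam (L2_class lam f) (L2_class lam h) = (\<integral>x. f x \<bullet> h x \<partial>lam)"
  using assms by (intro L2_inner_cong_AE L2_class_in rep_L2_class)

lemma L2_inner_commute: "L2_inner lam F H = L2_inner lam H F"
  by (simp add: L2_inner_def inner_commute)

lemma L2_inner_add_scale:
  assumes "F \<in> L2 lam" "f \<in> L2_fun lam" "h \<in> L2_fun lam"
  shows "L2_inner lam F (L2_class lam (\<lambda>x. f x + c *\<^sub>R h x)) =
    L2_inner lam F (L2_class lam f) + c * L2_inner lam F (L2_class lam h)"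
proof -
  have F: "F = L2_class lam (rep F)" using L2_class_rep[OF assms(1)] by simp
  have r: "rep F \<in> L2_fun lam" using rep_L2_fun[OF assms(1)] .
  have *: "(\<lambda>x. f x + c *\<^sub>R h x) \<in> L2_fun lam" using assms by (intro L2_fun_add L2_fun_scale)
  show ?thesis
    by (subst (1 2 3) F) (simp add: L2_inner_class r assms * inner_add_right integrable_inner_L2_fun)
qed

lemma L2_inner_self_pos:
  assumes "F \<in> L2 lam" "F \<noteq> L2_zero lam"
  shows "L2_inner lam F F > 0"
proof -
  have r: "rep F \<in> L2_fun lam" using rep_L2_fun[OF assms(1)] .
  have "L2_inner lam F F \<ge> 0" by (simp add: L2_inner_def)
  moreover have "L2_inner lam F F \<noteq> 0"
  proof
    assume "L2_inner lam F F = 0"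
    then have "AE x in lam. rep F x \<bullet> rep F x = 0"
      unfolding L2_inner_def using integral_nonneg_eq_0_iff_AE[OF integrable_inner_L2_fun[OF r r]]
      by simp
    then have "AE x in lam. rep F x = 0" by simp
    then have "L2_class lam (rep F) = L2_zero lam"
      unfolding L2_zero_def by (intro L2_class_cong r L2_fun_zero)
    then show False using assms L2_class_rep by metis
  qed
  ultimately show ?thesis by simp
qed

lemma openin_L2_topology:
  "openin (L2_topology lam) S \<longleftrightarrow>
    S \<subseteq> L2 lam \<and> (\<forall>F\<in>S. \<exists>r>0. \<forall>H\<in>L2 lam. L2_dist lam F H < r \<longrightarrow> H \<in> S)"
proof -
  interpret Metric_space "L2 lam" "L2_dist lam" by (rule Metric_space_L2)
  show ?thesis
    unfolding L2_topology_def openin_mtopology mball_def by blast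
qed

lemma space_L2_borel [simp]: "space (L2_borel lam) = L2 lam"
  unfolding L2_borel_def by (rule space_measure_of) (auto simp: openin_L2_topology)

lemma sets_L2_borel: "sets (L2_borel lam) = sigma_sets (L2 lam) {U. openin (L2_topology lam) U}"
  unfolding L2_borel_def by (rule sets_measure_of) (auto simp: openin_L2_topology)

lemma openin_sets_L2_borel: "openin (L2_topology lam) S \<Longrightarrow> S \<in> sets (L2_borel lam)"
  by (simp add: sets_L2_borel)

lemma L2_dist_power2: "(L2_dist lam F H)\<^sup>2 = (\<integral>x. (norm (rep F x - rep H x))\<^sup>2 \<partial>lam)"
  by (simp add: L2_dist_def)


section \<open>Measurability of the set of absolutely continuous push-forwards\<close>

text \<open>
  Lower semicontinuity of \<open>F \<mapsto> \<lambda>(F \<in> U)\<close>. A value of \<open>F\<close> that keeps distance \<open>1 / j\<close> from the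
  complement of \<open>U\<close> stays in \<open>U\<close> after a perturbation of size below \<open>1 / j\<close>, and by Chebyshev's inequality
  a small distance in the mean makes larger perturbations improbable.
\<close>

lemma openin_push_greater:
  fixes lam :: "(real ^ 'n) measure"
  assumes lam: "prob_space lam" and U: "open U"
  shows "openin (L2_topology lam) {F \<in> L2 lam. c < measure (push lam F) U}"
  unfolding openin_L2_topology
proof (intro conjI ballI)
  interpret prob_space lam by fact
  fix F assume "F \<in> {F \<in> L2 lam. c < measure (push lam F) U}"
  then have F: "F \<in> L2 lam" and cF: "c < measure (push lam F) U" by auto
  have m [measurable]: "rep H \<in> borel_measurable lam" if "H \<in> L2 lam" for H
    using rep_L2_fun[OF that] by (auto simp: L2_fun_def)
  \<comment> \<open>The points at distance at least \<open>1 / Suc j\<close> from the complement of \<open>U\<close>; being closed, these sets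
    are measurable, and they increase to \<open>U\<close>.\<close>
  define V where "V j = - (\<Union>z\<in>- U. ball z (1 / real (Suc j)))" for j
  have Vc: "V j \<in> sets borel" for j unfolding V_def by (intro borel_closed) auto
  interpret pF: prob_space "push lam F"
    unfolding push_def using F by (intro prob_space_distr) simp
  have "incseq V"
  proof (rule incseq_SucI)
    fix j
    have "1 / real (Suc (Suc j)) \<le> 1 / real (Suc j)" by (simp add: field_simps)
    then have "ball z (1 / real (Suc (Suc j))) \<subseteq> ball z (1 / real (Suc j))" for z :: "real ^ 'n"
      by (rule subset_ball)
    then show "V j \<subseteq> V (Suc j)" unfolding V_def by blast
  qed
  moreover have "(\<Union>j. V j) = U"
  proof (intro equalityI subsetI)
    fix y assume "y \<in> (\<Union>j. V j)"
    then show "y \<in> U" by (force simp: V_def)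
  next
    fix y assume "y \<in> U"
    then obtain e where e: "e > 0" "\<And>z. dist z y < e \<Longrightarrow> z \<in> U"
      using U open_dist by blast
    obtain j where "1 / real (Suc j) < e" using e(1) nat_approx_posE by blast
    then have "y \<in> V j" using e(2) by (fastforce simp: V_def)
    then show "y \<in> (\<Union>j. V j)" by blast
  qed
  ultimately have "(\<lambda>j. measure (push lam F) (V j)) \<longlonglongrightarrow> measure (push lam F) U"
    using pF.finite_Lim_measure_incseq[of V] Vc by (auto simp: push_def)
  then have "eventually (\<lambda>j. c < measure (push lam F) (V j)) sequentially"
    using cF by (rule order_tendstoD)
  then obtain j where j: "c < measure (push lam F) (V j)"
    by (auto simp: eventually_sequentially)
  define \<eta> where "\<eta> = measure (push lam F) (V j) - c"
  have \<eta>: "\<eta> > 0" using j by (simp add: \<eta>_def)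
  define r where "r = sqrt \<eta> / real (Suc j)"
  show "\<exists>r>0. \<forall>H\<in>L2 lam. L2_dist lam F H < r \<longrightarrow> H \<in> {F \<in> L2 lam. c < measure (push lam F) U}"
  proof (intro exI[of _ r] conjI ballI impI)
    show "0 < r" using \<eta> by (simp add: r_def)
    fix H assume H: "H \<in> L2 lam" and d: "L2_dist lam F H < r"
    let ?D = "\<lambda>x. rep F x - rep H x"
    have Dint: "integrable lam (\<lambda>x. (norm (?D x))\<^sup>2)"
      using L2_fun_diff[OF rep_L2_fun[OF F] rep_L2_fun[OF H]] by (simp add: L2_fun_def)
    define Z where "Z = {x \<in> space lam. norm (?D x) \<ge> 1 / real (Suc j)}"
    have Zm: "Z \<in> sets lam" unfolding Z_def using F H by measurable
    have "Z = {x \<in> space lam. (norm (?D x))\<^sup>2 \<ge> (1 / real (Suc j))\<^sup>2}"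
      by (auto simp: Z_def power_mono intro: power2_le_imp_le)
    then have "measure lam Z \<le> (\<integral>x. (norm (?D x))\<^sup>2 \<partial>lam) / (1 / real (Suc j))\<^sup>2"
      using integral_Markov_inequality_measure[OF Dint, of "{}" "(1 / real (Suc j))\<^sup>2"] by auto
    also have "\<dots> = (L2_dist lam F H * real (Suc j))\<^sup>2"
      by (simp add: L2_dist_power2[symmetric] power_mult_distrib power_divide)
    also have "\<dots> < (sqrt \<eta>)\<^sup>2"
    proof (rule power_strict_mono)
      show "L2_dist lam F H * real (Suc j) < sqrt \<eta>" using d by (simp add: r_def field_simps)
      show "0 \<le> L2_dist lam F H * real (Suc j)" by (simp add: L2_dist_def)
    qed simp
    finally have Zs: "measure lam Z < \<eta>" using \<eta> by simp
    have "rep F -` V j \<inter> space lam \<subseteq> (rep H -` U \<inter> space lam) \<union> Z"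
    proof
      fix x assume x: "x \<in> rep F -` V j \<inter> space lam"
      show "x \<in> (rep H -` U \<inter> space lam) \<union> Z"
      proof (cases "x \<in> Z")
        case False
        then have "dist (rep H x) (rep F x) < 1 / real (Suc j)"
          using x by (auto simp: Z_def dist_norm norm_minus_commute)
        then have "rep H x \<in> U" using x by (auto simp: V_def)
        then show ?thesis using x by simp
      qed simp
    qed
    then have "measure lam (rep F -` V j \<inter> space lam) \<le> measure lam ((rep H -` U \<inter> space lam) \<union> Z)"
      by (rule finite_measure_mono) (use U H Zm in \<open>auto intro!: measurable_sets[OF m]\<close>)
    also have "\<dots> \<le> measure lam (rep H -` U \<inter> space lam) + measure lam Z"
      by (rule measure_subadditive) (use U H Zm in \<open>auto intro!: measurable_sets[OF m] simp: emeasure_eq_measure\<close>)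
    finally have "measure (push lam F) (V j) \<le> measure (push lam H) U + measure lam Z"
      using Vc U F H by (simp add: push_def measure_distr)
    then show "H \<in> {F \<in> L2 lam. c < measure (push lam F) U}"
      using H Zs by (simp add: \<eta>_def)
  qed
qed auto

lemma push_in_P2:
  fixes lam :: "(real ^ 'n) measure"
  assumes lam: "prob_space lam" and F: "F \<in> L2 lam"
  shows "push lam F \<in> P2"
proof -
  have r: "rep F \<in> borel_measurable lam" "integrable lam (\<lambda>x. (norm (rep F x))\<^sup>2)"
    using rep_L2_fun[OF F] by (auto simp: L2_fun_def)
  then show ?thesis
    using lam by (auto simp: P2_def push_def prob_space.prob_space_distr integrable_distr_eq)
qed

text \<open>
  The \<open>\<epsilon>\<close>-\<open>\<delta>\<close> criterion expresses the set through countably many sets of the form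
  \<open>{F. \<lambda>(F \<in> U) \<le> c}\<close>, which are closed.
\<close>

lemma sets_push_P2_ac:
  fixes lam :: "(real ^ 'n) measure"
  assumes lam: "prob_space lam"
  shows "{F \<in> L2 lam. push lam F \<in> P2_ac} \<in> sets (L2_borel lam)"
proof -
  obtain \<U> :: "(real ^ 'n) set set" where \<U>: "countable \<U>" "\<And>U. U \<in> \<U> \<Longrightarrow> open U"
    "\<And>V. open V \<Longrightarrow> \<exists>U. range U \<subseteq> \<U> \<and> incseq U \<and> (\<Union>n::nat. U n) = V"
    by (rule open_exhausting_family) blast
  have "push lam F \<in> P2_ac \<longleftrightarrow> (\<forall>k. \<exists>m. \<forall>U\<in>\<U>. emeasure lborel U \<le> ennreal ((1/2) ^ m) \<longrightarrow>
      measure (push lam F) U \<le> 1 / real (Suc k))" if "F \<in> L2 lam" for F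
  proof -
    have P: "push lam F \<in> P2" by (rule push_in_P2[OF lam that])
    then have "finite_measure (push lam F)" "sets (push lam F) = sets borel"
      by (auto simp: P2_def prob_space.finite_measure)
    from absolutely_continuous_iff_open_family[OF this \<U>(2,3)]
    show ?thesis using P by (simp add: P2_ac_def)
  qed
  then have eq: "{F \<in> L2 lam. push lam F \<in> P2_ac} = {F \<in> space (L2_borel lam).
      \<forall>k. \<exists>m. \<forall>U\<in>\<U>. emeasure lborel U \<le> ennreal ((1/2) ^ m) \<longrightarrow>
      measure (push lam F) U \<le> 1 / real (Suc k)}" by auto
  have m: "{F \<in> space (L2_borel lam). measure (push lam F) U \<le> c} \<in> sets (L2_borel lam)"
    if "U \<in> \<U>" for U c
  proof -
    have "{F \<in> space (L2_borel lam). measure (push lam F) U \<le> c} =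
        space (L2_borel lam) - {F \<in> L2 lam. c < measure (push lam F) U}" by auto
    then show ?thesis
      using openin_sets_L2_borel[OF openin_push_greater[OF lam \<U>(2)[OF that], of c]]
      by (simp only: sets.compl_sets)
  qed
  have "{F \<in> space (L2_borel lam). emeasure lborel U \<le> e \<longrightarrow> measure (push lam F) U \<le> c}
      \<in> sets (L2_borel lam)" if "U \<in> \<U>" for U e c
    by (cases "emeasure lborel U \<le> e") (use m[OF that] sets.top[of "L2_borel lam"] in auto)
  then show ?thesis unfolding eq
    unfolding pred_def[symmetric]
    by (intro pred_intros_countable(1,2) measurable_pred_countable(1)[OF \<U>(1)])
qed


section \<open>Separability and cylinder sets\<close>

lemma sqrt_integral_lt_iff:
  "e > 0 \<Longrightarrow> sqrt (\<integral>x. (norm (f x))\<^sup>2 \<partial>M) < e \<longleftrightarrow> (\<integral>x. (norm (f x))\<^sup>2 \<partial>M) < e\<^sup>2"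
  by (metis real_sqrt_less_iff real_sqrt_unique less_imp_le)

lemma L2_fun_indicator:
  fixes lam :: "(real ^ 'n) measure"
  assumes "finite_measure lam" "A \<in> sets lam"
  shows "(\<lambda>x. indicator A x *\<^sub>R y) \<in> L2_fun lam"
proof -
  interpret finite_measure lam by fact
  have "(norm (indicator A x *\<^sub>R y))\<^sup>2 = indicator A x * (norm y)\<^sup>2" for x
    by (auto simp: indicator_def)
  then show ?thesis using assms(2)
    by (auto simp: L2_fun_def intro!: integrable_mult_left integrable_real_indicator
        simp: emeasure_eq_measure)
qed

lemma integral_indicator_diff:
  fixes lam :: "(real ^ 'n) measure"
  assumes "finite_measure lam" "A \<in> sets lam" "B \<in> sets lam" "A \<subseteq> B"
  shows "(\<integral>x. (norm (indicator B x *\<^sub>R y - indicator A x *\<^sub>R y))\<^sup>2 \<partial>lam) =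
    (norm y)\<^sup>2 * (measure lam B - measure lam A)"
proof -
  interpret finite_measure lam by fact
  have "(norm (indicator B x *\<^sub>R y - indicator A x *\<^sub>R y))\<^sup>2 = (norm y)\<^sup>2 * indicator (B - A) x" for x
    using assms(4) by (auto simp: indicator_def)
  then show ?thesis using assms by (simp add: finite_measure_Diff)
qed

text \<open>
  The dense set consists of the finite sums of indicators of members of a countable family of open
  sets, with coefficients in a countable dense set of vectors. Its closure contains, one after
  another, the multiples of indicators of these sets, of open sets, of Borel sets, then the simple
  functions, then everything.
\<close>

lemma L2_fun_separable:
  fixes lam :: "(real ^ 'n) measure"
  assumes lam: "prob_space lam" and sets: "sets lam = sets borel"
  obtains E where "countable E" "E \<subseteq> L2_fun lam"
    "\<And>f e. f \<in> L2_fun lam \<Longrightarrow> e > 0 \<Longrightarrow> \<exists>h\<in>E. sqrt (\<integral>x. (norm (f x - h x))\<^sup>2 \<partial>lam) < e"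
proof -
  interpret prob_space lam by fact
  have fin: "finite_measure lam" by unfold_locales
  have sp: "space lam = UNIV" using sets_eq_imp_space_eq[OF sets] by simp
  obtain \<U> :: "(real ^ 'n) set set" where \<U>: "countable \<U>" "\<And>U. U \<in> \<U> \<Longrightarrow> open U"
    "\<And>V. open V \<Longrightarrow> \<exists>U. range U \<subseteq> \<U> \<and> incseq U \<and> (\<Union>n::nat. U n) = V"
    by (rule open_exhausting_family) blast
  obtain Q :: "(real ^ 'n) set" where Q: "countable Q" "\<And>X. open X \<Longrightarrow> X \<noteq> {} \<Longrightarrow> \<exists>q\<in>Q. q \<in> X"
    by (rule countable_dense_setE) blast
  define ev where "ev l x = (\<Sum>(U, q)\<leftarrow>l. indicator U x *\<^sub>R q)"
    for l :: "((real ^ 'n) set \<times> (real ^ 'n)) list" and x :: "real ^ 'n"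
  define E where "E = ev ` lists (\<U> \<times> Q)"
  have "countable E" unfolding E_def using \<U>(1) Q(1) by (intro countable_image countable_lists) simp
  have meas: "A \<in> sets lam" if "open A" for A using that sets by simp
  have ev_fun: "ev l \<in> L2_fun lam" if "l \<in> lists (\<U> \<times> Q)" for l
    using that
  proof induction
    case Nil
    then show ?case by (simp add: ev_def[abs_def] L2_fun_zero)
  next
    case (Cons a l)
    then show ?case
      by (cases a) (auto simp: ev_def[abs_def] intro!: L2_fun_add L2_fun_indicator[OF fin] meas \<U>(2))
  qed
  then have E_fun: "E \<subseteq> L2_fun lam" by (auto simp: E_def)
  define d where "d f h = sqrt (\<integral>x. (norm (f x - h x))\<^sup>2 \<partial>lam)" for f h :: "real ^ 'n \<Rightarrow> real ^ 'n"
  define App where "App f \<longleftrightarrow> f \<in> L2_fun lam \<and> (\<forall>e>0. \<exists>h\<in>E. d f h < e)" for f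
  have tri: "d f k \<le> d f h + d h k" if "f \<in> L2_fun lam" "h \<in> L2_fun lam" "k \<in> L2_fun lam" for f h k
    using L2_dist_triangle_fun(2)[OF L2_fun_diff[OF that(1,2)] L2_fun_diff[OF that(2,3)]]
    by (simp add: d_def)
  have lim: "App f" if f: "f \<in> L2_fun lam" and ap: "\<And>e. e > 0 \<Longrightarrow> \<exists>g. App g \<and> d f g < e" for f
    unfolding App_def
  proof (intro conjI allI impI f)
    fix e :: real assume "e > 0"
    then obtain g where g: "App g" "d f g < e / 2" using ap[of "e / 2"] by auto
    then obtain h where h: "h \<in> E" "d g h < e / 2" using \<open>e > 0\<close> unfolding App_def by (meson half_gt_zero)
    then have "d f h < e" using tri[of f g h] f g E_fun by (auto simp: App_def)
    then show "\<exists>h\<in>E. d f h < e" using h by blast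
  qed
  have add: "App (\<lambda>x. f x + g x)" if f: "App f" and g: "App g" for f g
    unfolding App_def
  proof (intro conjI allI impI)
    show "(\<lambda>x. f x + g x) \<in> L2_fun lam" using f g by (auto simp: App_def L2_fun_add)
    fix e :: real assume "e > 0"
    then obtain h k where h: "h \<in> E" "d f h < e / 2" and k: "k \<in> E" "d g k < e / 2"
      using f g unfolding App_def by (meson half_gt_zero)
    have "d (\<lambda>x. f x + g x) (\<lambda>x. h x + k x) \<le> d f h + d g k"
    proof -
      have "(\<lambda>x. f x - h x) \<in> L2_fun lam" "(\<lambda>x. g x - k x) \<in> L2_fun lam"
        using f g h k E_fun by (auto simp: App_def intro!: L2_fun_diff)
      from L2_dist_triangle_fun(2)[OF this] show ?thesis
        by (simp add: d_def algebra_simps)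
    qed
    then have "d (\<lambda>x. f x + g x) (\<lambda>x. h x + k x) < e" using h k by linarith
    moreover have "(\<lambda>x. h x + k x) \<in> E"
    proof -
      obtain l m where "l \<in> lists (\<U> \<times> Q)" "m \<in> lists (\<U> \<times> Q)" "h = ev l" "k = ev m"
        using h k by (auto simp: E_def)
      then have "(\<lambda>x. h x + k x) = ev (l @ m)" "l @ m \<in> lists (\<U> \<times> Q)"
        by (auto simp: ev_def fun_eq_iff)
      then show ?thesis by (simp add: E_def)
    qed
    ultimately show "\<exists>h\<in>E. d (\<lambda>x. f x + g x) h < e" by blast
  qed
  have ind0: "App (\<lambda>x. indicator U x *\<^sub>R q)" if "U \<in> \<U>" "q \<in> Q" for U q
  proof -
    have "ev [(U, q)] \<in> E" using that by (auto simp: E_def)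
    moreover have "ev [(U, q)] = (\<lambda>x. indicator U x *\<^sub>R q)" by (simp add: ev_def fun_eq_iff)
    moreover have "d f f = 0" for f by (simp add: d_def)
    ultimately show ?thesis using E_fun unfolding App_def by (metis subsetD)
  qed
  have ind1: "App (\<lambda>x. indicator U x *\<^sub>R y)" if U: "U \<in> \<U>" for U y
  proof (rule lim)
    show "(\<lambda>x. indicator U x *\<^sub>R y) \<in> L2_fun lam" using U by (intro L2_fun_indicator fin meas \<U>(2))
    fix e :: real assume e: "e > 0"
    obtain q where q: "q \<in> Q" "q \<in> ball y e" using Q(2)[of "ball y e"] e by auto
    have "(norm (indicator U x *\<^sub>R y - indicator U x *\<^sub>R q))\<^sup>2 = (norm (y - q))\<^sup>2 * indicator U x" for x
      by (auto simp: indicator_def)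
    then have "(\<integral>x. (norm (indicator U x *\<^sub>R y - indicator U x *\<^sub>R q))\<^sup>2 \<partial>lam) = (norm (y - q))\<^sup>2 * measure lam U"
      using meas[OF \<U>(2)[OF U]] by simp
    also have "\<dots> \<le> (norm (y - q))\<^sup>2 * 1" by (intro mult_left_mono) auto
    also have "\<dots> < e\<^sup>2" using q by (auto simp: dist_norm intro!: power_strict_mono)
    finally have "d (\<lambda>x. indicator U x *\<^sub>R y) (\<lambda>x. indicator U x *\<^sub>R q) < e"
      unfolding d_def by (subst sqrt_integral_lt_iff[OF e])
    then show "\<exists>g. App g \<and> d (\<lambda>x. indicator U x *\<^sub>R y) g < e" using ind0[OF U q(1)] by blast
  qed
  have approx_pos: "\<exists>\<delta>>0. (norm y)\<^sup>2 * \<delta> < e\<^sup>2" if "e > 0" for e :: real and y :: "real ^ 'n"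
    using that by (intro exI[of _ "e\<^sup>2 / ((norm y)\<^sup>2 + 1)"])
      (auto simp: divide_simps add_nonneg_pos power2_eq_square)
  have ind2: "App (\<lambda>x. indicator V x *\<^sub>R y)" if V: "open V" for V y
  proof (rule lim)
    show "(\<lambda>x. indicator V x *\<^sub>R y) \<in> L2_fun lam" by (intro L2_fun_indicator fin meas V)
    fix e :: real assume e: "e > 0"
    obtain U where U: "range U \<subseteq> \<U>" "incseq U" "(\<Union>n::nat. U n) = V" using \<U>(3)[OF V] by blast
    have Um: "U n \<in> \<U>" for n using U(1) by blast
    have "(\<lambda>n. measure lam (U n)) \<longlonglongrightarrow> measure lam V"
      using finite_Lim_measure_incseq[OF _ U(2)] meas[OF \<U>(2)[OF Um]] U(3)
      by (simp add: image_subset_iff)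
    then have "(\<lambda>n. (norm y)\<^sup>2 * (measure lam V - measure lam (U n))) \<longlonglongrightarrow> (norm y)\<^sup>2 * (measure lam V - measure lam V)"
      by (intro tendsto_intros)
    then have "eventually (\<lambda>n. (norm y)\<^sup>2 * (measure lam V - measure lam (U n)) < e\<^sup>2) sequentially"
      by (rule order_tendstoD) (use e in simp)
    then obtain n where "(norm y)\<^sup>2 * (measure lam V - measure lam (U n)) < e\<^sup>2"
      by (auto simp: eventually_sequentially)
    moreover have "U n \<subseteq> V" using U(3) by blast
    ultimately have "d (\<lambda>x. indicator V x *\<^sub>R y) (\<lambda>x. indicator (U n) x *\<^sub>R y) < e"
      unfolding d_def
      by (subst sqrt_integral_lt_iff[OF e])
        (simp add: integral_indicator_diff[OF fin meas[OF \<U>(2)[OF Um]] meas[OF V]])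
    then show "\<exists>g. App g \<and> d (\<lambda>x. indicator V x *\<^sub>R y) g < e" using ind1[OF Um] by blast
  qed
  have ind3: "App (\<lambda>x. indicator A x *\<^sub>R y)" if A: "A \<in> sets lam" for A y
  proof (rule lim)
    show "(\<lambda>x. indicator A x *\<^sub>R y) \<in> L2_fun lam" by (intro L2_fun_indicator fin A)
    fix e :: real assume e: "e > 0"
    obtain \<delta> where \<delta>: "\<delta> > 0" "(norm y)\<^sup>2 * \<delta> < e\<^sup>2" using approx_pos[OF e] by blast
    have "emeasure lam A < emeasure lam A + ennreal \<delta>"
      using \<delta>(1) by (simp add: emeasure_eq_measure ennreal_plus[symmetric] ennreal_less_iff del: ennreal_plus)
    then have "(INF U \<in> {U. A \<subseteq> U \<and> open U}. emeasure lam U) < emeasure lam A + ennreal \<delta>"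
      using outer_regular[OF sets _ A[unfolded sets]] by (simp only: emeasure_finite infinity_ennreal_def simp_thms)
    then obtain V where V: "A \<subseteq> V" "open V" "emeasure lam V < emeasure lam A + ennreal \<delta>"
      by (auto simp: INF_less_iff)
    then have "measure lam V < measure lam A + \<delta>"
      using \<delta>(1) by (simp add: emeasure_eq_measure ennreal_plus[symmetric] ennreal_less_iff del: ennreal_plus)
    then have "(norm y)\<^sup>2 * (measure lam V - measure lam A) < e\<^sup>2"
      using \<delta>(2) by (intro order_le_less_trans[OF mult_left_mono \<delta>(2)]) auto
    moreover have "d (\<lambda>x. indicator A x *\<^sub>R y) (\<lambda>x. indicator V x *\<^sub>R y) =
        sqrt (\<integral>x. (norm (indicator V x *\<^sub>R y - indicator A x *\<^sub>R y))\<^sup>2 \<partial>lam)"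
      by (simp add: d_def norm_minus_commute)
    ultimately have "d (\<lambda>x. indicator A x *\<^sub>R y) (\<lambda>x. indicator V x *\<^sub>R y) < e"
      using e by (simp add: integral_indicator_diff[OF fin A meas[OF V(2)] V(1)] real_less_lsqrt)
    then show "\<exists>g. App g \<and> d (\<lambda>x. indicator A x *\<^sub>R y) g < e" using ind2[OF V(2)] by blast
  qed
  have zero: "App (\<lambda>x. 0)" using ind3[of "{}" 0] by simp
  have sum: "App (\<lambda>x. \<Sum>i\<in>I. g i x)" if "finite I" "\<And>i. i \<in> I \<Longrightarrow> App (g i)"
    for I :: "(real ^ 'n) set" and g
    using that by (induction I) (auto intro: add zero)
  have simple: "App s" if s: "simple_function lam s" for s
  proof -
    have "App (\<lambda>x. \<Sum>y\<in>range s. indicator (s -` {y}) x *\<^sub>R y)"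
    proof (rule sum)
      show "finite (range s)" using simple_functionD(1)[OF s] sp by simp
      show "App (\<lambda>x. indicator (s -` {y}) x *\<^sub>R y)" for y
        using simple_functionD(2)[OF s, of "{y}"] sp by (intro ind3) simp
    qed
    moreover have "(\<Sum>y\<in>range s. indicator (s -` {y}) x *\<^sub>R y) = s x" for x
    proof -
      have "(\<Sum>y\<in>range s. indicator (s -` {y}) x *\<^sub>R y) = (\<Sum>y\<in>range s. if y = s x then s x else 0)"
        by (intro sum.cong) (auto simp: indicator_def)
      also have "\<dots> = s x"
        using simple_functionD(1)[OF s] sp by simp
      finally show ?thesis .
    qed
    ultimately show ?thesis by simp
  qed
  have all: "App f" if f: "f \<in> L2_fun lam" for f
  proof (rule lim[OF f])
    fix e :: real assume e: "e > 0"
    have fm [measurable]: "f \<in> borel_measurable lam" and fi: "integrable lam (\<lambda>x. (norm (f x))\<^sup>2)"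
      using f by (auto simp: L2_fun_def)
    obtain s where s: "\<And>i. simple_function lam (s i)" "\<And>x. (\<lambda>i. s i x) \<longlonglongrightarrow> f x"
      "\<And>i x. norm (s i x) \<le> 2 * norm (f x)"
      using borel_measurable_implies_sequence_metric[OF fm, of 0] sp by auto
    have sm [measurable]: "s i \<in> borel_measurable lam" for i
      using s(1) by (rule borel_measurable_simple_function)
    have "(\<lambda>i. \<integral>x. (norm (f x - s i x))\<^sup>2 \<partial>lam) \<longlonglongrightarrow> (\<integral>x. 0 \<partial>lam)"
    proof (rule integral_dominated_convergence[where w = "\<lambda>x. 9 * (norm (f x))\<^sup>2"])
      show "AE x in lam. (\<lambda>i. (norm (f x - s i x))\<^sup>2) \<longlonglongrightarrow> 0"
      proof (rule AE_I2)
        fix x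
        have "(\<lambda>i. (norm (f x - s i x))\<^sup>2) \<longlonglongrightarrow> (norm (f x - f x))\<^sup>2"
          by (intro tendsto_intros s(2))
        then show "(\<lambda>i. (norm (f x - s i x))\<^sup>2) \<longlonglongrightarrow> 0" by simp
      qed
      show "AE x in lam. norm ((norm (f x - s i x))\<^sup>2) \<le> 9 * (norm (f x))\<^sup>2" for i
      proof (rule AE_I2)
        fix x
        have "norm (f x - s i x) \<le> 3 * norm (f x)"
          using norm_triangle_ineq4[of "f x" "s i x"] s(3)[of i x] by linarith
        then have "(norm (f x - s i x))\<^sup>2 \<le> (3 * norm (f x))\<^sup>2" by (rule power_mono) simp
        then show "norm ((norm (f x - s i x))\<^sup>2) \<le> 9 * (norm (f x))\<^sup>2"
          by (simp add: power_mult_distrib)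
      qed
    qed (use fi in auto)
    then have "eventually (\<lambda>i. (\<integral>x. (norm (f x - s i x))\<^sup>2 \<partial>lam) < e\<^sup>2) sequentially"
      by (intro order_tendstoD) (use e in auto)
    then obtain i where "(\<integral>x. (norm (f x - s i x))\<^sup>2 \<partial>lam) < e\<^sup>2"
      by (auto simp: eventually_sequentially)
    then have "d f (s i) < e" unfolding d_def by (subst sqrt_integral_lt_iff[OF e])
    then show "\<exists>g. App g \<and> d f g < e" using simple[OF s(1)] by blast
  qed
  show ?thesis
    by (rule that[OF \<open>countable E\<close> E_fun]) (use all in \<open>auto simp: App_def d_def\<close>)
qed

lemma L2_class_diff:
  assumes F: "F \<in> L2 lam" and K: "K \<in> L2 lam"
  defines "v \<equiv> L2_class lam (\<lambda>x. rep F x - rep K x)"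
  shows "v \<in> L2 lam"
    and "\<And>H. H \<in> L2 lam \<Longrightarrow> L2_inner lam H v = L2_inner lam H F - L2_inner lam H K"
    and "L2_inner lam v v = (L2_dist lam F K)\<^sup>2"
proof -
  have r: "rep F \<in> L2_fun lam" "rep K \<in> L2_fun lam" using rep_L2_fun F K by blast+
  have d: "(\<lambda>x. rep F x - rep K x) \<in> L2_fun lam" using r by (rule L2_fun_diff)
  show "v \<in> L2 lam" unfolding v_def using d by (rule L2_class_in)
  show "L2_inner lam H v = L2_inner lam H F - L2_inner lam H K" if "H \<in> L2 lam" for H
    using L2_inner_add_scale[OF that r, of "-1"] by (simp add: v_def L2_class_rep F K)
  show "L2_inner lam v v = (L2_dist lam F K)\<^sup>2"
    unfolding v_def L2_inner_class[OF d d] L2_dist_power2 by (simp add: power2_norm_eq_inner)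
qed

lemma L2_dist_power2_expand:
  assumes F: "F \<in> L2 lam" and H: "H \<in> L2 lam"
  shows "(L2_dist lam F H)\<^sup>2 = L2_inner lam F F - 2 * L2_inner lam F H + L2_inner lam H H"
proof -
  define v where "v = L2_class lam (\<lambda>x. rep F x - rep H x)"
  note d = L2_class_diff[OF F H, folded v_def]
  have "L2_inner lam v v = L2_inner lam v F - L2_inner lam v H" by (rule d(2)[OF d(1)])
  also have "\<dots> = L2_inner lam F v - L2_inner lam H v" by (simp only: L2_inner_commute)
  also have "\<dots> = L2_inner lam F F - 2 * L2_inner lam F H + L2_inner lam H H"
    using d(2)[OF F] d(2)[OF H] L2_inner_commute[of lam H F] by simp
  finally show ?thesis using d(3) by simp
qed

text \<open>
  The Cauchy-Schwarz inequality with a free parameter, which is the form in which it follows by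
  integrating a pointwise bound.
\<close>

lemma abs_L2_inner_le:
  assumes F: "F \<in> L2 lam" and H: "H \<in> L2 lam" and t: "t > 0"
  shows "2 * \<bar>L2_inner lam F H\<bar> \<le> t * L2_inner lam F F + L2_inner lam H H / t"
proof -
  have r: "rep F \<in> L2_fun lam" "rep H \<in> L2_fun lam" using rep_L2_fun F H by blast+
  let ?s = "sqrt t"
  have "2 * \<bar>rep F x \<bullet> rep H x\<bar> \<le> t * (rep F x \<bullet> rep F x) + (rep H x \<bullet> rep H x) / t" for x
  proof -
    have "2 * \<bar>rep F x \<bullet> rep H x\<bar> \<le> 2 * (norm (rep F x) * norm (rep H x))"
      using Cauchy_Schwarz_ineq2[of "rep F x" "rep H x"] by simp
    also have "\<dots> = 2 * (?s * norm (rep F x)) * (norm (rep H x) / ?s)" using t by simp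
    also have "\<dots> \<le> (?s * norm (rep F x))\<^sup>2 + (norm (rep H x) / ?s)\<^sup>2"
      by (rule sum_squares_bound)
    finally show ?thesis using t by (simp add: power_mult_distrib power_divide power2_norm_eq_inner)
  qed
  then have "(\<integral>x. 2 * \<bar>rep F x \<bullet> rep H x\<bar> \<partial>lam) \<le> (\<integral>x. t * (rep F x \<bullet> rep F x) + (rep H x \<bullet> rep H x) / t \<partial>lam)"
    by (intro integral_mono) (auto intro!: integrable_inner_L2_fun r)
  then have "2 * (\<integral>x. \<bar>rep F x \<bullet> rep H x\<bar> \<partial>lam) \<le> t * L2_inner lam F F + L2_inner lam H H / t"
    by (simp add: L2_inner_def integrable_inner_L2_fun r)
  moreover have "\<bar>L2_inner lam F H\<bar> \<le> (\<integral>x. \<bar>rep F x \<bullet> rep H x\<bar> \<partial>lam)"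
    unfolding L2_inner_def by (rule integral_abs_bound)
  ultimately show ?thesis by linarith
qed

lemma measurable_L2_inner:
  assumes H: "H \<in> L2 lam"
  shows "L2_inner lam H \<in> borel_measurable (L2_borel lam)"
proof (rule borel_measurableI)
  fix S :: "real set" assume S: "open S"
  have "openin (L2_topology lam) {F \<in> L2 lam. L2_inner lam H F \<in> S}"
    unfolding openin_L2_topology
  proof (intro conjI ballI)
    fix F assume "F \<in> {F \<in> L2 lam. L2_inner lam H F \<in> S}"
    then have F: "F \<in> L2 lam" "L2_inner lam H F \<in> S" by auto
    then obtain e where e: "e > 0" "\<And>y. dist y (L2_inner lam H F) < e \<Longrightarrow> y \<in> S"
      using S open_dist by blast
    define n where "n = L2_inner lam H H"
    have n: "n \<ge> 0" by (simp add: n_def L2_inner_def)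
    \<comment> \<open>With this parameter the first term of \<open>abs_L2_inner_le\<close> is at most \<open>e\<close>; the radius \<open>sqrt (e * t)\<close>
      makes the second one smaller than \<open>e\<close>.\<close>
    define t where "t = e / (n + 1)"
    have t: "t > 0" using e n by (simp add: t_def)
    show "\<exists>r>0. \<forall>K\<in>L2 lam. L2_dist lam F K < r \<longrightarrow> K \<in> {F \<in> L2 lam. L2_inner lam H F \<in> S}"
    proof (intro exI[of _ "sqrt (e * t)"] conjI ballI impI)
      show "0 < sqrt (e * t)" using e t by simp
      fix K assume K: "K \<in> L2 lam" and lt: "L2_dist lam F K < sqrt (e * t)"
      define v where "v = L2_class lam (\<lambda>x. rep F x - rep K x)"
      note d = L2_class_diff[OF F(1) K, folded v_def]
      have "(L2_dist lam F K)\<^sup>2 < (sqrt (e * t))\<^sup>2"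
        using lt by (intro power_strict_mono) (auto simp: L2_dist_def)
      then have "L2_inner lam v v / t < e" using e t d(3) by (simp add: field_simps)
      moreover have "t * n \<le> e" using e n by (simp add: t_def field_simps)
      ultimately have "\<bar>L2_inner lam H v\<bar> < e" using abs_L2_inner_le[OF H d(1) t] by (simp add: n_def)
      then have "dist (L2_inner lam H K) (L2_inner lam H F) < e"
        using d(2)[OF H] by (simp add: dist_real_def abs_minus_commute)
      then show "K \<in> {F \<in> L2 lam. L2_inner lam H F \<in> S}" using K e by simp
    qed
  qed auto
  then show "L2_inner lam H -` S \<inter> space (L2_borel lam) \<in> sets (L2_borel lam)"
    by (auto dest!: openin_sets_L2_borel simp: vimage_def Int_def conj_commute)
qed

text \<open>
  Since \<open>2 \<langle>H, F\<rangle> - \<langle>H, H\<rangle> = \<langle>F, F\<rangle> - \<parallel>F - H\<parallel>\<^sup>2\<close>, the squared norm of \<open>F\<close> is the supremum of the left side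
  over a dense set of \<open>H\<close>. This recovers the norm from countably many linear functionals.
\<close>

lemma L2_inner_self_le_iff_dense:
  assumes E: "E \<subseteq> L2 lam" and dense: "\<And>F e. F \<in> L2 lam \<Longrightarrow> e > 0 \<Longrightarrow> \<exists>H\<in>E. L2_dist lam F H < e"
    and F: "F \<in> L2 lam"
  shows "L2_inner lam F F \<le> c \<longleftrightarrow> (\<forall>H\<in>E. 2 * L2_inner lam H F - L2_inner lam H H \<le> c)"
proof
  have eq: "2 * L2_inner lam H F - L2_inner lam H H = L2_inner lam F F - (L2_dist lam F H)\<^sup>2"
    if "H \<in> E" for H
    using L2_dist_power2_expand[OF F, of H] that E L2_inner_commute[of lam F H] by auto
  show "\<forall>H\<in>E. 2 * L2_inner lam H F - L2_inner lam H H \<le> c" if "L2_inner lam F F \<le> c"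
  proof
    fix H assume "H \<in> E"
    then show "2 * L2_inner lam H F - L2_inner lam H H \<le> c"
      using that eq[of H] zero_le_power2[of "L2_dist lam F H"] by linarith
  qed
  show "L2_inner lam F F \<le> c" if *: "\<forall>H\<in>E. 2 * L2_inner lam H F - L2_inner lam H H \<le> c"
  proof (rule field_le_epsilon)
    fix e :: real assume e: "e > 0"
    then obtain H where H: "H \<in> E" "L2_dist lam F H < sqrt e" using dense[OF F, of "sqrt e"] by auto
    then have "(L2_dist lam F H)\<^sup>2 < (sqrt e)\<^sup>2" by (intro power_strict_mono) (auto simp: L2_dist_def)
    then show "L2_inner lam F F \<le> c + e" using * eq[OF H(1)] H(1) e by fastforce
  qed
qed

text \<open>
  Lists of constraints, so that intersecting two cylinder sets is concatenation and constraints can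
  be removed one at a time by induction.
\<close>

definition cylinders :: "(real ^ 'n) measure \<Rightarrow> 'n field_class set set" where
  "cylinders lam = {{F \<in> L2 lam. \<forall>(H, B)\<in>set l. L2_inner lam H F \<in> B} | l.
     set l \<subseteq> L2 lam \<times> sets (borel :: real measure)}"

lemma cylinderI:
  "set l \<subseteq> L2 lam \<times> sets borel \<Longrightarrow> {F \<in> L2 lam. \<forall>(H, B)\<in>set l. L2_inner lam H F \<in> B} \<in> cylinders lam"
  by (auto simp: cylinders_def)

lemma cylinders_subset: "cylinders lam \<subseteq> Pow (L2 lam)"
  by (auto simp: cylinders_def)

lemma Int_stable_cylinders: "Int_stable (cylinders lam)"
proof (rule Int_stableI)
  fix a b assume "a \<in> cylinders lam" "b \<in> cylinders lam"
  then obtain l m where lm: "set l \<subseteq> L2 lam \<times> sets borel" "set m \<subseteq> L2 lam \<times> sets borel"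
    and a: "a = {F \<in> L2 lam. \<forall>(H, B)\<in>set l. L2_inner lam H F \<in> B}"
    and b: "b = {F \<in> L2 lam. \<forall>(H, B)\<in>set m. L2_inner lam H F \<in> B}"
    unfolding cylinders_def by blast
  have "a \<inter> b = {F \<in> L2 lam. \<forall>(H, B)\<in>set (l @ m). L2_inner lam H F \<in> B}"
    unfolding a b set_append by blast
  then show "a \<inter> b \<in> cylinders lam" using cylinderI[of "l @ m" lam] lm by simp
qed

lemma space_in_cylinders: "L2 lam \<in> cylinders lam"
  using cylinderI[of "[]" lam] by simp

text \<open>
  The functionals are continuous, which gives one inclusion. For the other one, distances to a fixed
  point are measurable with respect to the cylinder sets because the norm is a countable supremum
  of functionals, and by separability each open set is a countable union of balls.
\<close>

lemma sets_L2_borel_eq_cylinders: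
  fixes lam :: "(real ^ 'n) measure"
  assumes lam: "prob_space lam" and sets: "sets lam = sets borel"
  shows "sets (L2_borel lam) = sigma_sets (L2 lam) (cylinders lam)"
proof
  show "sigma_sets (L2 lam) (cylinders lam) \<subseteq> sets (L2_borel lam)"
  proof (rule sets.sigma_sets_subset[of "cylinders lam" "L2_borel lam", simplified])
    show "cylinders lam \<subseteq> sets (L2_borel lam)"
    proof
      fix C assume "C \<in> cylinders lam"
      then obtain l where l: "set l \<subseteq> L2 lam \<times> sets borel"
        and C: "C = {F \<in> L2 lam. \<forall>(H, B)\<in>set l. L2_inner lam H F \<in> B}"
        unfolding cylinders_def by blast
      have "{F \<in> space (L2_borel lam). \<forall>p\<in>set l. L2_inner lam (fst p) F \<in> snd p} \<in> sets (L2_borel lam)"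
      proof (rule sets.sets_Collect_finite_All)
        fix p assume "p \<in> set l"
        then have "fst p \<in> L2 lam" "snd p \<in> sets borel" using l by auto
        then show "{F \<in> space (L2_borel lam). L2_inner lam (fst p) F \<in> snd p} \<in> sets (L2_borel lam)"
          using measurable_sets[OF measurable_L2_inner, of "fst p" lam "snd p"]
          by (simp add: vimage_def Int_def conj_commute)
      qed simp
      then show "C \<in> sets (L2_borel lam)" by (simp add: C case_prod_beta)
    qed
  qed
  define S where "S = sigma (L2 lam) (cylinders lam)"
  have spS: "space S = L2 lam" unfolding S_def using cylinders_subset by (rule space_measure_of)
  have setsS: "sets S = sigma_sets (L2 lam) (cylinders lam)"
    unfolding S_def using cylinders_subset by (rule sets_measure_of)
  have inner: "L2_inner lam H \<in> borel_measurable S" if "H \<in> L2 lam" for H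
  proof (rule measurableI)
    fix B :: "real set" assume "B \<in> sets borel"
    then show "L2_inner lam H -` B \<inter> space S \<in> sets S"
      using cylinderI[of "[(H, B)]" lam] that
      by (auto simp: setsS spS vimage_def Int_def conj_commute intro: sigma_sets.Basic)
  qed simp
  obtain E0 where E0: "countable E0" "E0 \<subseteq> L2_fun lam"
    "\<And>f e. f \<in> L2_fun lam \<Longrightarrow> e > 0 \<Longrightarrow> \<exists>h\<in>E0. sqrt (\<integral>x. (norm (f x - h x))\<^sup>2 \<partial>lam) < e"
    using L2_fun_separable[OF lam sets] by blast
  define E where "E = L2_class lam ` E0"
  have E: "countable E" "E \<subseteq> L2 lam" using E0 by (auto simp: E_def L2_class_in)
  have dense: "\<exists>H\<in>E. L2_dist lam F H < e" if F: "F \<in> L2 lam" and e: "e > 0" for F e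
  proof -
    obtain h where h: "h \<in> E0" "sqrt (\<integral>x. (norm (rep F x - h x))\<^sup>2 \<partial>lam) < e"
      using E0(3)[OF rep_L2_fun[OF F] e] by blast
    have hf: "h \<in> L2_fun lam" using h E0 by blast
    have "L2_dist lam F (L2_class lam h) = sqrt (\<integral>x. (norm (rep F x - h x))\<^sup>2 \<partial>lam)"
      unfolding L2_dist_def
    proof (intro arg_cong[of _ _ sqrt] integral_cong_AE)
      have "rep F \<in> borel_measurable lam" "h \<in> borel_measurable lam"
        "rep (L2_class lam h) \<in> borel_measurable lam"
        using rep_L2_fun[OF F] hf rep_L2_fun[OF L2_class_in[OF hf]] by (auto simp: L2_fun_def)
      then show "(\<lambda>x. (norm (rep F x - rep (L2_class lam h) x))\<^sup>2) \<in> borel_measurable lam"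
        "(\<lambda>x. (norm (rep F x - h x))\<^sup>2) \<in> borel_measurable lam" by measurable
      show "AE x in lam. (norm (rep F x - rep (L2_class lam h) x))\<^sup>2 = (norm (rep F x - h x))\<^sup>2"
        using rep_L2_class[OF hf] by eventually_elim simp
    qed
    then have "L2_dist lam F (L2_class lam h) < e" using h(2) by (simp only:)
    then show ?thesis using h(1) unfolding E_def by blast
  qed
  have dist: "(\<lambda>F. (L2_dist lam F K)\<^sup>2) \<in> borel_measurable S" if K: "K \<in> L2 lam" for K
    unfolding borel_measurable_iff_le
  proof
    fix c
    have "(L2_dist lam F K)\<^sup>2 \<le> c \<longleftrightarrow>
        (\<forall>H\<in>E. 2 * (L2_inner lam H F - L2_inner lam H K) - L2_inner lam H H \<le> c)" if F: "F \<in> L2 lam" for F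
    proof -
      define v where "v = L2_class lam (\<lambda>x. rep F x - rep K x)"
      note d = L2_class_diff[OF F K, folded v_def]
      have "L2_inner lam H v = L2_inner lam H F - L2_inner lam H K" if "H \<in> E" for H
        using d(2) that E by blast
      then show ?thesis using L2_inner_self_le_iff_dense[OF E(2) dense d(1), of c] d(3) by simp
    qed
    then have "{F \<in> space S. (L2_dist lam F K)\<^sup>2 \<le> c} = {F \<in> space S.
        \<forall>H\<in>E. 2 * (L2_inner lam H F - L2_inner lam H K) - L2_inner lam H H \<le> c}"
      by (auto simp: spS)
    also have "\<dots> \<in> sets S"
      unfolding pred_def[symmetric]
    proof (rule measurable_pred_countable(1)[OF E(1)])
      fix H assume "H \<in> E"
      then have [measurable]: "L2_inner lam H \<in> borel_measurable S" using inner E by blast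
      show "Measurable.pred S (\<lambda>F. 2 * (L2_inner lam H F - L2_inner lam H K) - L2_inner lam H H \<le> c)"
        by measurable
    qed
    finally show "{F \<in> space S. (L2_dist lam F K)\<^sup>2 \<le> c} \<in> sets S" .
  qed
  have ball: "{F \<in> L2 lam. L2_dist lam F K < 1 / real (Suc n)} \<in> sets S" if K: "K \<in> L2 lam" for K n
  proof -
    have "{F \<in> L2 lam. L2_dist lam F K < 1 / real (Suc n)} =
        {F \<in> space S. (L2_dist lam F K)\<^sup>2 < (1 / real (Suc n))\<^sup>2}"
      by (auto simp: spS L2_dist_def intro!: power_strict_mono intro: power2_less_imp_less
          simp del: real_sqrt_pow2)
    also have "\<dots> \<in> sets S" using dist[OF K] by measurable
    finally show ?thesis .
  qed
  interpret M: Metric_space "L2 lam" "L2_dist lam" by (rule Metric_space_L2)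
  have "U \<in> sets S" if "openin (L2_topology lam) U" for U
  proof -
    have sub: "U \<subseteq> L2 lam" using that by (simp add: openin_L2_topology)
    define I where "I = {(K, n). K \<in> E \<and> {F \<in> L2 lam. L2_dist lam F K < 1 / real (Suc n)} \<subseteq> U}"
    have "U = (\<Union>(K, n)\<in>I. {F \<in> L2 lam. L2_dist lam F K < 1 / real (Suc n)})"
    proof (intro equalityI subsetI)
      fix F assume F: "F \<in> U"
      then obtain r where r: "r > 0" "\<And>H. H \<in> L2 lam \<Longrightarrow> L2_dist lam F H < r \<Longrightarrow> H \<in> U"
        using \<open>openin (L2_topology lam) U\<close> by (auto simp: openin_L2_topology)
      obtain n where n: "1 / real (Suc n) < r / 2" using r(1) nat_approx_posE[of "r / 2"] by auto
      have FL: "F \<in> L2 lam" using F sub by auto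
      obtain K where K: "K \<in> E" "L2_dist lam F K < 1 / real (Suc n)"
        using dense[OF FL, of "1 / real (Suc n)"] by auto
      have KL: "K \<in> L2 lam" using K E by auto
      have "H \<in> U" if H: "H \<in> L2 lam" "L2_dist lam H K < 1 / real (Suc n)" for H
      proof (rule r(2)[OF H(1)])
        have "L2_dist lam F H \<le> L2_dist lam F K + L2_dist lam K H"
          by (rule M.triangle[OF FL KL H(1)])
        then show "L2_dist lam F H < r" using K(2) H(2) n M.commute[of H K] by simp
      qed
      then have "(K, n) \<in> I" using K by (auto simp: I_def)
      then show "F \<in> (\<Union>(K, n)\<in>I. {F \<in> L2 lam. L2_dist lam F K < 1 / real (Suc n)})"
        using FL K by auto
    qed (auto simp: I_def)
    moreover have "countable I"
      by (rule countable_subset[of _ "E \<times> UNIV"]) (auto simp: I_def E(1))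
    then have "(\<Union>(K, n)\<in>I. {F \<in> L2 lam. L2_dist lam F K < 1 / real (Suc n)}) \<in> sets S"
      by (rule sets.countable_UN') (use ball E in \<open>auto simp: I_def\<close>)
    ultimately show ?thesis by simp
  qed
  then have "sigma_sets (space S) {U. openin (L2_topology lam) U} \<subseteq> sets S"
    by (intro sets.sigma_sets_subset) auto
  then show "sets (L2_borel lam) \<subseteq> sigma_sets (L2 lam) (cylinders lam)"
    by (simp add: sets_L2_borel spS setsS)
qed

lemma measurable_L2_borelI:
  fixes lam :: "(real ^ 'n) measure"
  assumes lam: "prob_space lam" "sets lam = sets borel"
    and in_L2: "\<And>\<omega>. \<omega> \<in> space M \<Longrightarrow> \<phi> \<omega> \<in> L2 lam"
    and inner: "\<And>H. H \<in> L2 lam \<Longrightarrow> (\<lambda>\<omega>. L2_inner lam H (\<phi> \<omega>)) \<in> borel_measurable M"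
  shows "\<phi> \<in> M \<rightarrow>\<^sub>M L2_borel lam"
proof (rule measurable_sigma_sets[OF sets_L2_borel_eq_cylinders[OF lam] cylinders_subset])
  show "\<phi> \<in> space M \<rightarrow> L2 lam" using in_L2 by auto
  fix C assume "C \<in> cylinders lam"
  then obtain l where l: "set l \<subseteq> L2 lam \<times> sets borel"
    and C: "C = {F \<in> L2 lam. \<forall>(H, B)\<in>set l. L2_inner lam H F \<in> B}"
    unfolding cylinders_def by blast
  have "\<phi> -` C \<inter> space M = {\<omega> \<in> space M. \<forall>p\<in>set l. L2_inner lam (fst p) (\<phi> \<omega>) \<in> snd p}"
    using in_L2 by (auto simp: C)
  also have "\<dots> \<in> sets M"
  proof (rule sets.sets_Collect_finite_All)
    fix p assume "p \<in> set l"
    then have "fst p \<in> L2 lam" "snd p \<in> sets borel" using l by auto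
    then show "{\<omega> \<in> space M. L2_inner lam (fst p) (\<phi> \<omega>) \<in> snd p} \<in> sets M"
      using measurable_sets[OF inner, of "fst p" "snd p"]
      by (simp add: vimage_def Int_def conj_commute)
  qed simp
  finally show "\<phi> -` C \<inter> space M \<in> sets M" .
qed


section \<open>Measures are determined by their Fourier transforms\<close>

lemma integrable_bounded_weight:
  fixes f :: "'a \<Rightarrow> 'b::{banach, second_countable_topology}"
  assumes "finite_measure M" "f \<in> borel_measurable M" "\<And>x. norm (f x) \<le> C"
  shows "integrable M f"
  using assms by (intro finite_measure.integrable_const_bound[of _ _ C]) auto

text \<open>
  The uniqueness theorem of Levy concerns probability measures; finite measures are normalized. The
  total mass is the value of the transform at \<open>0\<close>.
\<close>

lemma distr_eqI_fourier:
  fixes X :: "'a \<Rightarrow> real" and Y :: "'b \<Rightarrow> real"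
  assumes M: "finite_measure M" and N: "finite_measure N"
    and X [measurable]: "X \<in> borel_measurable M" and Y [measurable]: "Y \<in> borel_measurable N"
    and eq: "\<And>u. (CLINT x|M. iexp (u * X x)) = (CLINT x|N. iexp (u * Y x))"
  shows "distr M borel X = distr N borel Y"
proof -
  interpret M: finite_measure M by fact
  interpret N: finite_measure N by fact
  define m where "m = measure M (space M)"
  have mass: "measure N (space N) = m"
  proof -
    have "complex_of_real (measure M (space M)) = complex_of_real (measure N (space N))"
      using eq[of 0] by (simp add: scaleR_conv_of_real)
    then show ?thesis by (simp only: of_real_eq_iff m_def)
  qed
  show ?thesis
  proof (cases "m = 0")
    case True
    then have z: "emeasure M (space M) = 0" "emeasure N (space N) = 0"
      using mass by (simp_all add: M.emeasure_eq_measure N.emeasure_eq_measure m_def)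
    show ?thesis
    proof (rule measure_eqI)
      fix A assume "A \<in> sets (distr M borel X)"
      then have A: "A \<in> sets borel" by simp
      have "emeasure M (X -` A \<inter> space M) = 0" "emeasure N (Y -` A \<inter> space N) = 0"
        using z by (auto intro!: emeasure_eq_0[OF sets.top])
      then show "emeasure (distr M borel X) A = emeasure (distr N borel Y) A"
        using A by (simp add: emeasure_distr)
    qed simp
  next
    case False
    then have m: "m > 0" by (simp add: m_def zero_less_measure_iff)
    define P where "P K = density K (\<lambda>_::real. ennreal (1 / m))" for K
    have P: "real_distribution (P (distr K borel Z))" and
      char: "char (P (distr K borel Z)) u = complex_of_real (1 / m) * (CLINT x|K. iexp (u * Z x))"
      if K: "finite_measure K" "measure K (space K) = m" and Z [measurable]: "Z \<in> borel_measurable K"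
      for K :: "'c measure" and Z u
    proof -
      interpret K: finite_measure K by fact
      have "emeasure (P (distr K borel Z)) UNIV = ennreal (1 / m) * emeasure K (space K)"
        by (simp add: P_def emeasure_density nn_integral_cmult emeasure_distr)
      also have "\<dots> = 1"
        using m K(2) by (simp add: K.emeasure_eq_measure ennreal_mult[symmetric])
      finally have "prob_space (P (distr K borel Z))"
        by (intro prob_spaceI) (simp add: P_def)
      then show "real_distribution (P (distr K borel Z))"
        by (simp add: real_distribution_def real_distribution_axioms_def P_def)
      show "char (P (distr K borel Z)) u = complex_of_real (1 / m) * (CLINT x|K. iexp (u * Z x))"
        unfolding char_def P_def using m
        by (subst integral_density) (auto simp: integral_distr scaleR_conv_of_real)
    qed
    have "P (distr M borel X) = P (distr N borel Y)"
      by (rule Levy_uniqueness)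
        (use M N mass eq in \<open>auto intro!: P simp: fun_eq_iff char m_def[symmetric]\<close>)
    moreover have "density (P K) (\<lambda>_. ennreal m) = K" if "sets K = sets borel" for K
    proof -
      have "density (P K) (\<lambda>_. ennreal m) = density K (\<lambda>_. ennreal (1 / m) * ennreal m)"
        unfolding P_def by (subst density_density_eq) auto
      also have "ennreal (1 / m) * ennreal m = 1" using m by (simp add: ennreal_mult[symmetric])
      finally show ?thesis by (simp add: density_1)
    qed
    ultimately show ?thesis by (metis sets_distr)
  qed
qed

text \<open>
  One step of the passage from Fourier transforms to cylinder sets: a factor \<open>indicator B (X x)\<close>
  is inserted. As functions of \<open>B\<close>, both sides are complex measures, to which the theorem on the line
  does not apply directly. The weights \<open>1 + Re (c * iexp (\<theta> x))\<close> with \<open>norm c \<le> 1\<close> are nonnegative, hence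
  define finite measures whose transforms are covered by the hypothesis; the choices \<open>c = 1\<close> and
  \<open>c = - \<i>\<close> return the real and the imaginary part after the weight for \<open>c = 0\<close> is subtracted.
\<close>

lemma fourier_restrict:
  fixes X \<theta> :: "'a \<Rightarrow> real"
  assumes M: "finite_measure M" and N: "finite_measure N" and sets: "sets N = sets M"
    and A: "A \<in> sets M" and X: "X \<in> borel_measurable M" and \<theta>: "\<theta> \<in> borel_measurable M"
    and eq: "\<And>u v. (CLINT x|M. indicator A x *\<^sub>R iexp (u * X x + v * \<theta> x)) =
      (CLINT x|N. indicator A x *\<^sub>R iexp (u * X x + v * \<theta> x))"
    and B: "B \<in> sets borel"
  shows "(CLINT x|M. indicator (A \<inter> X -` B) x *\<^sub>R iexp (\<theta> x)) =
    (CLINT x|N. indicator (A \<inter> X -` B) x *\<^sub>R iexp (\<theta> x))"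
proof -
  define k where "k c x = indicator A x * (1 + Re (c * iexp (\<theta> x)))" for c x
  have kM: "finite_measure (density K (k c))" "k c \<in> borel_measurable K"
    "AE x in K. 0 \<le> k c x" "integrable K (\<lambda>x. k c x * indicator B (X x))"
    and kint: "(CLINT x|density K (k c). iexp (u * X x)) =
      (CLINT x|K. indicator A x *\<^sub>R iexp (u * X x + 0 * \<theta> x))
      + c / 2 * (CLINT x|K. indicator A x *\<^sub>R iexp (u * X x + 1 * \<theta> x))
      + cnj c / 2 * (CLINT x|K. indicator A x *\<^sub>R iexp (u * X x + (-1) * \<theta> x))"
    if c: "norm c \<le> 1" and K: "finite_measure K" "sets K = sets M" for c K u
  proof -
    interpret K: finite_measure K by fact
    have [measurable]: "A \<in> sets K" "X \<in> borel_measurable K" "\<theta> \<in> borel_measurable K"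
      using A X \<theta> K(2) by (auto simp: measurable_cong_sets[OF K(2) refl])
    note [measurable] = B
    show km [measurable]: "k c \<in> borel_measurable K" unfolding k_def by measurable
    have re: "\<bar>Re (c * iexp (\<theta> x))\<bar> \<le> 1" for x
      using order_trans[OF abs_Re_le_cmod[of "c * iexp (\<theta> x)"]] c by (simp add: norm_mult)
    then have "- 1 \<le> Re (c * iexp (\<theta> x))" "Re (c * iexp (\<theta> x)) \<le> 1" for x
      by (metis abs_le_D2 minus_le_iff, metis abs_le_D1)
    then have "0 \<le> 1 + Re (c * iexp (\<theta> x))" "1 + Re (c * iexp (\<theta> x)) \<le> 2" for x
      by (smt (verit))+
    then have k0: "0 \<le> k c x" "k c x \<le> 2" for x
      unfolding k_def indicator_def by (cases "x \<in> A"; fastforce)+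
    then show "AE x in K. 0 \<le> k c x" by simp
    show "integrable K (\<lambda>x. k c x * indicator B (X x))"
      by (rule integrable_bounded_weight[OF K(1), of _ 2]) (use k0 in \<open>auto simp: indicator_def\<close>)
    have "(\<integral>\<^sup>+x. ennreal (k c x) \<partial>K) \<le> (\<integral>\<^sup>+x. 2 \<partial>K)"
      using k0 by (intro nn_integral_mono) (metis ennreal_leI ennreal_numeral)
    also have "\<dots> < \<infinity>" by (simp add: K.emeasure_eq_measure ennreal_mult_less_top)
    finally show "finite_measure (density K (k c))"
      by (intro finite_measureI) (simp add: emeasure_density cong: nn_integral_cong)
    have int: "integrable K (\<lambda>x. indicator A x *\<^sub>R iexp (u * X x + v * \<theta> x))" for v
      by (rule integrable_bounded_weight[OF K(1), of _ 1]) (auto simp: indicator_def)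
    have lin: "(CLINT x|K. f0 x + a * f1 x + b * f2 x) = (CLINT x|K. f0 x) + a * (CLINT x|K. f1 x) + b * (CLINT x|K. f2 x)"
      if "integrable K f0" "integrable K f1" "integrable K f2" for f0 f1 f2 :: "'a \<Rightarrow> complex" and a b
      using that by simp
    have "(CLINT x|density K (k c). iexp (u * X x)) = (CLINT x|K. k c x *\<^sub>R iexp (u * X x))"
      using k0 by (intro integral_density) auto
    also have "(\<lambda>x. k c x *\<^sub>R iexp (u * X x)) = (\<lambda>x. indicator A x *\<^sub>R iexp (u * X x + 0 * \<theta> x)
      + c / 2 * (indicator A x *\<^sub>R iexp (u * X x + 1 * \<theta> x))
      + cnj c / 2 * (indicator A x *\<^sub>R iexp (u * X x + (-1) * \<theta> x)))"
    proof
      fix x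
      define e e' w where "e = iexp (\<theta> x)" and "e' = iexp (- \<theta> x)" and "w = iexp (u * X x)"
      have "cnj e = e'" by (simp add: e_def e'_def exp_cnj)
      then have re_eq: "complex_of_real (Re (c * e)) = (c * e + cnj c * e') / 2"
        using complex_add_cnj[of "c * e"] by simp
      have "iexp (u * X x + v) = w * iexp v" for v
        by (simp add: w_def exp_add[symmetric] distrib_left)
      from this[of "0 * \<theta> x"] this[of "1 * \<theta> x"] this[of "(-1) * \<theta> x"]
      have shift: "iexp (u * X x + 0 * \<theta> x) = w" "iexp (u * X x + 1 * \<theta> x) = w * e"
        "iexp (u * X x + (-1) * \<theta> x) = w * e'"
        by (simp_all add: e_def e'_def)
      have "k c x *\<^sub>R w = indicator A x *\<^sub>R w + c / 2 * (indicator A x *\<^sub>R (w * e))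
        + cnj c / 2 * (indicator A x *\<^sub>R (w * e'))"
        unfolding k_def e_def[symmetric]
        by (cases "x \<in> A") (simp_all add: scaleR_conv_of_real re_eq field_simps del: times_complex.sel)
      then show "k c x *\<^sub>R iexp (u * X x) = indicator A x *\<^sub>R iexp (u * X x + 0 * \<theta> x)
        + c / 2 * (indicator A x *\<^sub>R iexp (u * X x + 1 * \<theta> x))
        + cnj c / 2 * (indicator A x *\<^sub>R iexp (u * X x + (-1) * \<theta> x))"
        by (simp only: shift w_def[symmetric])
    qed
    finally show "(CLINT x|density K (k c). iexp (u * X x)) =
      (CLINT x|K. indicator A x *\<^sub>R iexp (u * X x + 0 * \<theta> x))
      + c / 2 * (CLINT x|K. indicator A x *\<^sub>R iexp (u * X x + 1 * \<theta> x))
      + cnj c / 2 * (CLINT x|K. indicator A x *\<^sub>R iexp (u * X x + (-1) * \<theta> x))"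
      by (simp only: lin[OF int int int])
  qed
  have Xm: "X \<in> borel_measurable K" if "sets K = sets M" for K
    using X by (simp add: measurable_cong_sets[OF that refl])
  have weight: "(\<integral>x. k c x * indicator B (X x) \<partial>M) = (\<integral>x. k c x * indicator B (X x) \<partial>N)"
    if c: "norm c \<le> 1" for c
  proof -
    have "distr (density M (k c)) borel X = distr (density N (k c)) borel X"
    proof (rule distr_eqI_fourier)
      show "finite_measure (density M (k c))" "finite_measure (density N (k c))"
        using kM(1)[OF c M refl] kM(1)[OF c N sets] .
      show "X \<in> borel_measurable (density M (k c))" "X \<in> borel_measurable (density N (k c))"
        using X Xm[OF sets] by simp_all
      show "(CLINT x|density M (k c). iexp (u * X x)) = (CLINT x|density N (k c). iexp (u * X x))" for u
        by (simp only: kint[OF c M refl] kint[OF c N sets] eq)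
    qed
    moreover have "(\<integral>x. indicator B (X x) \<partial>density K (k c)) =
        (\<integral>x. indicator B x \<partial>distr (density K (k c)) borel X :: real)" if "sets K = sets M" for K
      by (rule integral_distr[symmetric]) (use B Xm[OF that] in simp_all)
    ultimately have "(\<integral>x. indicator B (X x) \<partial>density M (k c)) =
        (\<integral>x. indicator B (X x) \<partial>density N (k c) :: real)"
      using sets by metis
    then show ?thesis
      using kM(2,3)[OF c M refl] kM(2,3)[OF c N sets] B X Xm[OF sets]
      by (simp add: integral_density)
  qed
  have re: "(\<integral>x. indicator (A \<inter> X -` B) x * Re (c * iexp (\<theta> x)) \<partial>M) =
    (\<integral>x. indicator (A \<inter> X -` B) x * Re (c * iexp (\<theta> x)) \<partial>N)" if c: "norm c \<le> 1" for c
  proof -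
    have "(\<lambda>x. indicator (A \<inter> X -` B) x * Re (c * iexp (\<theta> x))) =
      (\<lambda>x. k c x * indicator B (X x) - k 0 x * indicator B (X x))"
      by (auto simp: fun_eq_iff k_def indicator_def)
    then show ?thesis
      using weight[OF c] weight[of 0] kM(4)[OF c M refl] kM(4)[OF c N sets] kM(4)[OF _ M refl, of 0]
        kM(4)[OF _ N sets, of 0] by simp
  qed
  have int: "integrable K (\<lambda>x. indicator (A \<inter> X -` B) x *\<^sub>R iexp (\<theta> x))"
    if K: "finite_measure K" "sets K = sets M" for K
  proof (rule integrable_bounded_weight[OF K(1), of _ 1])
    have [measurable]: "A \<in> sets K" "X \<in> borel_measurable K" "\<theta> \<in> borel_measurable K"
      using A X \<theta> K(2) by (auto simp: measurable_cong_sets[OF K(2) refl])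
    note [measurable] = B
    have "(\<lambda>x. indicator (A \<inter> X -` B) x *\<^sub>R iexp (\<theta> x)) =
        (\<lambda>x. (indicator A x * indicator B (X x)) *\<^sub>R iexp (\<theta> x))"
      by (auto simp: fun_eq_iff indicator_def)
    then show "(\<lambda>x. indicator (A \<inter> X -` B) x *\<^sub>R iexp (\<theta> x)) \<in> borel_measurable K" by simp
  qed (auto simp: indicator_def)
  show ?thesis
  proof (rule complex_eqI)
    show "Re (CLINT x|M. indicator (A \<inter> X -` B) x *\<^sub>R iexp (\<theta> x)) =
        Re (CLINT x|N. indicator (A \<inter> X -` B) x *\<^sub>R iexp (\<theta> x))"
      using re[of 1] int[OF M refl] int[OF N sets] by (simp flip: integral_Re)
    show "Im (CLINT x|M. indicator (A \<inter> X -` B) x *\<^sub>R iexp (\<theta> x)) =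
        Im (CLINT x|N. indicator (A \<inter> X -` B) x *\<^sub>R iexp (\<theta> x))"
      using re[of "- \<i>"] int[OF M refl] int[OF N sets] by (simp flip: integral_Im)
  qed
qed

lemma L2_inner_combination:
  fixes u v :: real
  assumes H: "H \<in> L2 lam" and K: "K \<in> L2 lam"
  defines "L \<equiv> L2_class lam (\<lambda>x. u *\<^sub>R rep H x + v *\<^sub>R rep K x)"
  shows "L \<in> L2 lam"
    and "F \<in> L2 lam \<Longrightarrow> L2_inner lam L F = u * L2_inner lam H F + v * L2_inner lam K F"
proof -
  have r: "rep H \<in> L2_fun lam" "rep K \<in> L2_fun lam" using rep_L2_fun H K by blast+
  then have "(\<lambda>x. u *\<^sub>R rep H x + v *\<^sub>R rep K x) \<in> L2_fun lam"
    by (intro L2_fun_add L2_fun_scale)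
  then show "L \<in> L2 lam" unfolding L_def by (rule L2_class_in)
  assume F: "F \<in> L2 lam"
  have "L2_inner lam F (L2_class lam (\<lambda>x. u *\<^sub>R rep H x)) = u * L2_inner lam F H"
  proof -
    have "L2_inner lam F (L2_class lam (\<lambda>x. 0)) = 0"
      using L2_inner_class[OF rep_L2_fun[OF F] L2_fun_zero] by (simp add: L2_class_rep[OF F])
    then show ?thesis
      using L2_inner_add_scale[OF F L2_fun_zero r(1), of u] by (simp add: L2_class_rep[OF H])
  qed
  then show "L2_inner lam L F = u * L2_inner lam H F + v * L2_inner lam K F"
    using L2_inner_add_scale[OF F L2_fun_scale[OF r(1)] r(2), of u v]
    by (simp add: L_def L2_class_rep[OF K] L2_inner_commute[of lam _ F])
qed

text \<open>
  The constraints of a cylinder set are inserted one by one with \<open>fourier_restrict\<close>. Its hypothesis is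
  the induction hypothesis for another functional, because linear combinations of functionals are
  functionals; hence \<open>K\<close> is generalized in the induction on the list of constraints.
\<close>

lemma L2_measure_eqI_fourier:
  fixes lam :: "(real ^ 'n) measure"
  assumes lam: "prob_space lam" "sets lam = sets borel"
    and M: "prob_space M" "sets M = sets (L2_borel lam)"
    and N: "prob_space N" "sets N = sets (L2_borel lam)"
    and eq: "\<And>H. H \<in> L2 lam \<Longrightarrow> (CLINT F|M. iexp (L2_inner lam H F)) = (CLINT F|N. iexp (L2_inner lam H F))"
  shows "M = N"
proof -
  interpret M: prob_space M by fact
  interpret N: prob_space N by fact
  have spM: "space M = L2 lam" and spN: "space N = L2 lam"
    using sets_eq_imp_space_eq[OF M(2)] sets_eq_imp_space_eq[OF N(2)] by simp_all
  have fin: "finite_measure M" "finite_measure N" by unfold_locales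
  have sNM: "sets N = sets M" using M N by simp
  have inner: "L2_inner lam H \<in> borel_measurable M" if "H \<in> L2 lam" for H
    using measurable_L2_inner[OF that] by (simp add: measurable_cong_sets[OF M(2) refl])
  define C where "C l = {F \<in> L2 lam. \<forall>(H, B)\<in>set l. L2_inner lam H F \<in> B}"
    for l :: "('n field_class \<times> real set) list"
  have Csets: "C l \<in> sets M" if "set l \<subseteq> L2 lam \<times> sets borel" for l
    using cylinderI[OF that] by (auto simp: C_def M(2) sets_L2_borel_eq_cylinders[OF lam] intro: sigma_sets.Basic)
  have main: "(CLINT F|M. indicator (C l) F *\<^sub>R iexp (L2_inner lam K F)) =
      (CLINT F|N. indicator (C l) F *\<^sub>R iexp (L2_inner lam K F))"
    if "set l \<subseteq> L2 lam \<times> sets borel" "K \<in> L2 lam" for l K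
    using that
  proof (induction l arbitrary: K)
    case Nil
    have "(CLINT F|P. indicator (C []) F *\<^sub>R iexp (L2_inner lam K F)) = (CLINT F|P. iexp (L2_inner lam K F))"
      if "space P = L2 lam" for P
      by (rule Bochner_Integration.integral_cong) (auto simp: that C_def)
    then show ?case using eq[OF Nil(2)] spM spN by simp
  next
    case (Cons p l)
    obtain H B where p: "p = (H, B)" by force
    have H: "H \<in> L2 lam" and B: "B \<in> sets borel" and l: "set l \<subseteq> L2 lam \<times> sets borel"
      using Cons.prems(1) p by auto
    have K: "K \<in> L2 lam" by fact
    have "C (p # l) = C l \<inter> L2_inner lam H -` B" by (auto simp: C_def p)
    moreover have "(CLINT F|M. indicator (C l \<inter> L2_inner lam H -` B) F *\<^sub>R iexp (L2_inner lam K F)) =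
      (CLINT F|N. indicator (C l \<inter> L2_inner lam H -` B) F *\<^sub>R iexp (L2_inner lam K F))"
    proof (rule fourier_restrict[OF fin sNM Csets[OF l] inner[OF H] inner[OF K] _ B])
      fix u v
      define L where "L = L2_class lam (\<lambda>x. u *\<^sub>R rep H x + v *\<^sub>R rep K x)"
      note L = L2_inner_combination[OF H K, where u = u and v = v, folded L_def]
      have "(CLINT F|P. indicator (C l) F *\<^sub>R iexp (u * L2_inner lam H F + v * L2_inner lam K F)) =
          (CLINT F|P. indicator (C l) F *\<^sub>R iexp (L2_inner lam L F))" if "space P = L2 lam" for P
        by (rule Bochner_Integration.integral_cong) (auto simp: that L(2))
      then show "(CLINT F|M. indicator (C l) F *\<^sub>R iexp (u * L2_inner lam H F + v * L2_inner lam K F)) =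
          (CLINT F|N. indicator (C l) F *\<^sub>R iexp (u * L2_inner lam H F + v * L2_inner lam K F))"
        using Cons.IH[OF l L(1)] spM spN by simp
    qed
    ultimately show ?case by simp
  qed
  show "M = N"
  proof (rule measure_eqI_generator_eq[OF Int_stable_cylinders cylinders_subset])
    fix X assume "X \<in> cylinders lam"
    then obtain l where l: "set l \<subseteq> L2 lam \<times> sets borel" and X: "X = C l"
      unfolding cylinders_def C_def by blast
    have Z: "L2_zero lam \<in> L2 lam" unfolding L2_zero_def by (intro L2_class_in L2_fun_zero)
    have "L2_inner lam (L2_zero lam) F = 0" if F: "F \<in> L2 lam" for F
      using L2_inner_class[OF L2_fun_zero rep_L2_fun[OF F]] by (simp add: L2_class_rep[OF F] L2_zero_def)
    then have "(CLINT F|P. indicator (C l) F *\<^sub>R iexp (L2_inner lam (L2_zero lam) F)) =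
        (CLINT F|P. complex_of_real (indicator (C l) F))" if "space P = L2 lam" for P
      by (intro Bochner_Integration.integral_cong) (auto simp: that scaleR_conv_of_real)
    then have "(CLINT F|M. complex_of_real (indicator (C l) F)) = (CLINT F|N. complex_of_real (indicator (C l) F))"
      using main[OF l Z] spM spN by simp
    then have "measure M (C l) = measure N (C l)"
      using Csets[OF l] sNM by (simp add: integral_complex_of_real)
    then show "emeasure M X = emeasure N X"
      by (simp add: X M.emeasure_eq_measure N.emeasure_eq_measure)
  next
    show "sets M = sigma_sets (L2 lam) (cylinders lam)" "sets N = sigma_sets (L2 lam) (cylinders lam)"
      using M(2) N(2) sets_L2_borel_eq_cylinders[OF lam] by simp_all
    show "range (\<lambda>_::nat. L2 lam) \<subseteq> cylinders lam" using space_in_cylinders by auto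
  qed auto
qed


section \<open>Resampling a Gaussian field along an eigenvector\<close>

text \<open>
  The degenerate case \<open>s = 0\<close> is a point mass. Otherwise the moments are those of the density, and the
  transform is obtained from the one of the standard normal law by rescaling.
\<close>

lemma normal_law_properties:
  assumes "s \<ge> 0"
  shows "prob_space (normal_law m s)" "sets (normal_law m s) = sets borel" "space (normal_law m s) = UNIV"
    and "(\<integral>x. x \<partial>normal_law m s) = m"
    and "(\<integral>x. (x - m)\<^sup>2 \<partial>normal_law m s) = s\<^sup>2"
    and "(CLINT x|normal_law 0 s. iexp (u * x)) = complex_of_real (exp (- (u * s)\<^sup>2 / 2))"
proof -
  have "prob_space (normal_law m s) \<and> sets (normal_law m s) = sets borel \<and> space (normal_law m s) = UNIV \<and>
    (\<integral>x. x \<partial>normal_law m s) = m \<and> (\<integral>x. (x - m)\<^sup>2 \<partial>normal_law m s) = s\<^sup>2 \<and>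
    (CLINT x|normal_law 0 s. iexp (u * x)) = complex_of_real (exp (- (u * s)\<^sup>2 / 2))"
  proof (cases "s = 0")
    case True
    then show ?thesis by (simp add: normal_law_def prob_space_return integral_return)
  next
    case False
    then have s: "s > 0" using assms by simp
    interpret N: prob_space "density lborel (normal_density 0 s)" by (rule prob_space_normal_density[OF s])
    have "distributed (density lborel (normal_density 0 s)) lborel (\<lambda>x. x) (normal_density 0 s)"
      by (auto simp: distributed_def distr_id2 intro!: measurable_ident_sets)
    then have "distributed (density lborel (normal_density 0 s)) lborel (\<lambda>x. x / s) std_normal_density"
      using N.normal_standard_normal_convert[OF s, of "\<lambda>x. x" 0] by simp
    then have std: "std_normal_distribution = distr (density lborel (normal_density 0 s)) lborel (\<lambda>x. x / s)"
      by (simp add: distributed_def)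
    have "(CLINT x|density lborel (normal_density 0 s). iexp (u * x)) =
        (CLINT x|density lborel (normal_density 0 s). iexp ((u * s) * (x / s)))" using s by simp
    also have "\<dots> = char std_normal_distribution (u * s)"
      unfolding char_def std by (rule integral_distr[symmetric]) auto
    finally have char: "(CLINT x|density lborel (normal_density 0 s). iexp (u * x)) =
        complex_of_real (exp (- (u * s)\<^sup>2 / 2))" by (simp add: char_std_normal_distribution)
    have "(\<integral>x. x \<partial>density lborel (normal_density m s)) = m"
      using integral_normal_moment_nz_1[OF s, of m] by (subst integral_density) auto
    moreover have "(\<integral>x. (x - m)\<^sup>2 \<partial>density lborel (normal_density m s)) = s\<^sup>2"
      using integral_normal_moment_even[OF s, of m 1] by (subst integral_density) auto
    ultimately show ?thesis
      using char False prob_space_normal_density[OF s, of m] by (simp add: normal_law_def)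
  qed
  then show "prob_space (normal_law m s)" "sets (normal_law m s) = sets borel" "space (normal_law m s) = UNIV"
    "(\<integral>x. x \<partial>normal_law m s) = m" "(\<integral>x. (x - m)\<^sup>2 \<partial>normal_law m s) = s\<^sup>2"
    "(CLINT x|normal_law 0 s. iexp (u * x)) = complex_of_real (exp (- (u * s)\<^sup>2 / 2))" by blast+
qed

text \<open>
  The parameters of the normal law of a functional are its mean and its standard deviation, that is,
  zero and the square root of the covariance form.
\<close>

lemma centered_gaussian_fourier:
  fixes lam :: "(real ^ 'n) measure"
  assumes G: "L2_gaussian lam G" "L2_centered lam G" "L2_covariance lam G Q" and H: "H \<in> L2 lam"
  shows "(CLINT F|G. iexp (L2_inner lam H F)) = complex_of_real (exp (- L2_inner lam H (Q H) / 2))"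
proof -
  obtain m s where s: "s \<ge> 0" and law: "distr G borel (L2_inner lam H) = normal_law m s"
    using G(1) H by (auto simp: L2_gaussian_def)
  note N = normal_law_properties[OF s]
  have meas [measurable]: "L2_inner lam H \<in> borel_measurable G"
    using measurable_L2_inner[OF H] G(1) by (auto simp: L2_gaussian_def cong: measurable_cong_sets)
  have "m = (\<integral>x. x \<partial>distr G borel (L2_inner lam H))" using N(4) law by simp
  also have "\<dots> = 0"
    using G(2) H by (simp add: integral_distr L2_centered_def has_bochner_integral_integral_eq)
  finally have m: "m = 0" .
  have "s\<^sup>2 = (\<integral>x. x\<^sup>2 \<partial>distr G borel (L2_inner lam H))" using N(5)[of m] law m by simp
  also have "\<dots> = (\<integral>F. L2_inner lam H F * L2_inner lam H F \<partial>G)"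
    by (simp add: integral_distr power2_eq_square)
  also have "\<dots> = L2_inner lam H (Q H)"
    using G(3) H by (simp add: L2_covariance_def has_bochner_integral_integral_eq)
  finally have var: "s\<^sup>2 = L2_inner lam H (Q H)" .
  have "(CLINT F|G. iexp (L2_inner lam H F)) = (CLINT x|distr G borel (L2_inner lam H). iexp (1 * x))"
    by (simp add: integral_distr)
  also have "\<dots> = complex_of_real (exp (- s\<^sup>2 / 2))" using N(6)[of 1] by (simp add: law m)
  finally show ?thesis by (simp add: var)
qed

lemma L2_inner_scale:
  assumes F: "F \<in> L2 lam" and H: "H \<in> L2 lam"
  shows "L2_inner lam F (L2_scale lam c H) = c * L2_inner lam F H"
proof -
  have "L2_inner lam F (L2_scale lam c H) = (\<integral>x. rep F x \<bullet> (c *\<^sub>R rep H x) \<partial>lam)"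
    unfolding L2_scale_def using rep_L2_class[OF L2_fun_scale[OF rep_L2_fun[OF H]], of c]
    by (intro L2_inner_cong_AE L2_class_in L2_fun_scale rep_L2_fun F H) auto
  then show ?thesis by (simp add: L2_inner_def)
qed

text \<open>
  The eigenvalue is positive by strict positivity, so \<open>g\<close> is an eigenvector of the inverse for \<open>1 / c\<close>.
\<close>

lemma eigenvector_of_inverse:
  assumes op: "L2_operator lam (L2 lam) (inv_into D A)" and D: "D \<subseteq> L2 lam"
    and pos: "L2_strictly_positive lam D A" and bij: "bij_betw A D (L2 lam)"
    and g: "g \<in> D" "g \<noteq> L2_zero lam" and eig: "A g = L2_scale lam c g"
  shows "c > 0" and "\<And>H. H \<in> L2 lam \<Longrightarrow> L2_inner lam H (inv_into D A g) = L2_inner lam H g / c"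
proof -
  have gL: "g \<in> L2 lam" using g D by blast
  have "0 < L2_inner lam g (A g)" using pos g by (simp add: L2_strictly_positive_def)
  also have "\<dots> = c * L2_inner lam g g" by (simp add: eig L2_inner_scale gL)
  finally show c: "c > 0" using L2_inner_self_pos[OF gL g(2)] by (simp add: zero_less_mult_iff)
  have "inv_into D A (A g) = g" using bij g by (simp add: bij_betw_def inv_into_f_f)
  moreover have "inv_into D A (A g) = L2_scale lam c (inv_into D A g)"
    using op gL by (simp add: eig L2_operator_def)
  ultimately have Qg: "L2_scale lam c (inv_into D A g) = g" by simp
  have QL: "inv_into D A g \<in> L2 lam" using op gL by (auto simp: L2_operator_def)
  show "L2_inner lam H (inv_into D A g) = L2_inner lam H g / c" if "H \<in> L2 lam" for H
    using L2_inner_scale[OF that QL, of c] c by (simp add: Qg)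
qed

text \<open>
  The coefficient of \<open>F\<close> along \<open>g\<close> is replaced by \<open>t\<close>.
\<close>

definition resample :: "(real ^ 'n) measure \<Rightarrow> 'n field_class \<Rightarrow> 'n field_class \<Rightarrow> real \<Rightarrow> 'n field_class" where
  "resample lam g F t = L2_class lam
    (\<lambda>x. rep F x + (t - L2_inner lam g F / L2_inner lam g g) *\<^sub>R rep g x)"

lemma resample_in: "g \<in> L2 lam \<Longrightarrow> F \<in> L2 lam \<Longrightarrow> resample lam g F t \<in> L2 lam"
  unfolding resample_def by (intro L2_class_in L2_fun_add L2_fun_scale rep_L2_fun)

lemma L2_inner_resample:
  assumes "H \<in> L2 lam" "g \<in> L2 lam" "F \<in> L2 lam"
  shows "L2_inner lam H (resample lam g F t) =
    L2_inner lam H F + (t - L2_inner lam g F / L2_inner lam g g) * L2_inner lam H g"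
  unfolding resample_def using assms
  by (subst L2_inner_add_scale) (simp_all add: rep_L2_fun L2_class_rep)

lemma measurable_resample:
  fixes lam :: "(real ^ 'n) measure"
  assumes lam: "prob_space lam" "sets lam = sets borel" and g: "g \<in> L2 lam"
    and G: "sets G = sets (L2_borel lam)" and N: "sets N = sets borel"
  shows "(\<lambda>(F, t). resample lam g F t) \<in> G \<Otimes>\<^sub>M N \<rightarrow>\<^sub>M L2_borel lam"
proof (rule measurable_L2_borelI[OF lam])
  have spG: "space G = L2 lam" using sets_eq_imp_space_eq[OF G] by simp
  show "(case \<omega> of (F, t) \<Rightarrow> resample lam g F t) \<in> L2 lam" if "\<omega> \<in> space (G \<Otimes>\<^sub>M N)" for \<omega>
    using that g by (auto simp: space_pair_measure spG resample_in)
  fix H assume H: "H \<in> L2 lam"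
  have m [measurable]: "L2_inner lam K \<in> borel_measurable G" if "K \<in> L2 lam" for K
    using measurable_L2_inner[OF that] by (simp add: measurable_cong_sets[OF G refl])
  have t [measurable]: "(\<lambda>t. t) \<in> borel_measurable N"
    by (simp add: measurable_cong_sets[OF N refl])
  have "(\<lambda>\<omega>. L2_inner lam H (fst \<omega>) + (snd \<omega> - L2_inner lam g (fst \<omega>) / L2_inner lam g g) * L2_inner lam H g)
      \<in> borel_measurable (G \<Otimes>\<^sub>M N)"
    by (intro borel_measurable_add borel_measurable_times borel_measurable_diff borel_measurable_divide
        measurable_compose[OF measurable_fst m] measurable_compose[OF measurable_snd t] H g) auto
  moreover have "L2_inner lam H (case \<omega> of (F, t) \<Rightarrow> resample lam g F t) =
      L2_inner lam H (fst \<omega>) + (snd \<omega> - L2_inner lam g (fst \<omega>) / L2_inner lam g g) * L2_inner lam H g"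
    if "\<omega> \<in> space (G \<Otimes>\<^sub>M N)" for \<omega>
    using that g H by (auto simp: space_pair_measure spG L2_inner_resample)
  ultimately show "(\<lambda>\<omega>. L2_inner lam H (case \<omega> of (F, t) \<Rightarrow> resample lam g F t)) \<in> borel_measurable (G \<Otimes>\<^sub>M N)"
    by (subst measurable_cong)
qed

text \<open>
  The vector \<open>K\<close> is the projection of \<open>H\<close> to the orthogonal complement of \<open>g\<close>, and pairing \<open>K\<close> with \<open>F\<close> is pairing
  \<open>H\<close> with the residual of \<open>F\<close>. Since \<open>g\<close> is an eigenvector, the variance of the pairing of \<open>H\<close> with \<open>F\<close> splits
  into this variance and the contribution of the coefficient along \<open>g\<close>.
\<close>

lemma covariance_residual:
  fixes lam :: "(real ^ 'n) measure"
  assumes G: "L2_gaussian lam G" "L2_covariance lam G Q"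
    and g: "g \<in> L2 lam" and n: "L2_inner lam g g = n" "n > 0"
    and eig: "\<And>H. H \<in> L2 lam \<Longrightarrow> L2_inner lam H (Q g) = L2_inner lam H g / c"
    and H: "H \<in> L2 lam"
  defines "K \<equiv> L2_class lam (\<lambda>x. 1 *\<^sub>R rep H x + (- (L2_inner lam H g / n)) *\<^sub>R rep g x)"
  shows "L2_inner lam K (Q K) = L2_inner lam H (Q H) - (L2_inner lam H g)\<^sup>2 / (c * n)"
proof -
  let ?a = "L2_inner lam H g / n"
  note K = L2_inner_combination[OF H g, where u = 1 and v = "- ?a", folded K_def]
  have spG: "space G = L2 lam"
    using G(1) sets_eq_imp_space_eq[of G "L2_borel lam"] by (simp add: L2_gaussian_def)
  have cov: "has_bochner_integral G (\<lambda>F. L2_inner lam F1 F * L2_inner lam F2 F) (L2_inner lam F1 (Q F2))"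
    if "F1 \<in> L2 lam" "F2 \<in> L2 lam" for F1 F2
    using G(2) that by (simp add: L2_covariance_def)
  have "has_bochner_integral G (\<lambda>F. L2_inner lam H F * L2_inner lam H F
      + (- 2 * ?a) * (L2_inner lam H F * L2_inner lam g F) + ?a\<^sup>2 * (L2_inner lam g F * L2_inner lam g F))
      (L2_inner lam H (Q H) + (- 2 * ?a) * L2_inner lam H (Q g) + ?a\<^sup>2 * L2_inner lam g (Q g))"
    by (intro has_bochner_integral_add has_bochner_integral_mult_right cov H g)
  moreover have "L2_inner lam K F * L2_inner lam K F = L2_inner lam H F * L2_inner lam H F
      + (- 2 * ?a) * (L2_inner lam H F * L2_inner lam g F) + ?a\<^sup>2 * (L2_inner lam g F * L2_inner lam g F)"
    if "F \<in> space G" for F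
  proof -
    have "(1 * x + (- b) * y) * (1 * x + (- b) * y) = x * x + (- 2 * b) * (x * y) + b\<^sup>2 * (y * y)"
      for x y b :: real by (simp add: power2_eq_square algebra_simps)
    then show ?thesis using that by (simp only: K(2) spG)
  qed
  then have "has_bochner_integral G (\<lambda>F. L2_inner lam K F * L2_inner lam K F) x \<longleftrightarrow>
      has_bochner_integral G (\<lambda>F. L2_inner lam H F * L2_inner lam H F
      + (- 2 * ?a) * (L2_inner lam H F * L2_inner lam g F) + ?a\<^sup>2 * (L2_inner lam g F * L2_inner lam g F)) x" for x
    by (intro has_bochner_integral_cong) auto
  ultimately have "L2_inner lam K (Q K) =
      L2_inner lam H (Q H) + (- 2 * ?a) * L2_inner lam H (Q g) + ?a\<^sup>2 * L2_inner lam g (Q g)"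
    using cov[OF K(1) K(1)] has_bochner_integral_eq by blast
  also have "\<dots> = L2_inner lam H (Q H) - (L2_inner lam H g)\<^sup>2 / (c * n)"
    using n by (cases "c = 0") (simp_all add: eig H g n(1) field_simps power2_eq_square)
  finally show ?thesis .
qed

text \<open>
  The coefficient along \<open>g\<close> has variance \<open>\<langle>g, Q g\<rangle> / \<langle>g, g\<rangle>\<^sup>2 = 1 / (c * \<langle>g, g\<rangle>)\<close>, which is
  the value of \<open>\<sigma>\<^sup>2\<close>. The transform of the resampled law at \<open>H\<close> is a product of two normal transforms, and
  \<open>covariance_residual\<close> says that their variances add up to the one of \<open>H\<close> under \<open>G\<close>.
\<close>

lemma distr_resample:
  fixes lam :: "(real ^ 'n) measure"
  assumes lam: "prob_space lam" "sets lam = sets borel"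
    and G: "L2_gaussian lam G" "L2_centered lam G" "L2_covariance lam G Q"
    and g: "g \<in> L2 lam" "g \<noteq> L2_zero lam" and c: "c > 0"
    and eig: "\<And>H. H \<in> L2 lam \<Longrightarrow> L2_inner lam H (Q g) = L2_inner lam H g / c"
  defines "\<sigma> \<equiv> 1 / sqrt (c * L2_inner lam g g)"
  shows "distr (G \<Otimes>\<^sub>M normal_law 0 \<sigma>) (L2_borel lam) (\<lambda>(F, t). resample lam g F t) = G"
proof (rule L2_measure_eqI_fourier[OF lam])
  define n where "n = L2_inner lam g g"
  have n: "n > 0" using L2_inner_self_pos[OF g] by (simp add: n_def)
  have \<sigma>: "\<sigma> \<ge> 0" "\<sigma>\<^sup>2 = 1 / (c * n)" using c n by (auto simp: \<sigma>_def n_def[symmetric] power_divide)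
  have Gp: "prob_space G" and Gs: "sets G = sets (L2_borel lam)" using G(1) by (auto simp: L2_gaussian_def)
  have spG: "space G = L2 lam" using sets_eq_imp_space_eq[OF Gs] by simp
  note N = normal_law_properties[OF \<sigma>(1), of 0]
  interpret G: prob_space G by fact
  interpret N: prob_space "normal_law 0 \<sigma>" by fact
  interpret GN: pair_prob_space G "normal_law 0 \<sigma>" ..
  have m: "(\<lambda>(F, t). resample lam g F t) \<in> G \<Otimes>\<^sub>M normal_law 0 \<sigma> \<rightarrow>\<^sub>M L2_borel lam"
    by (rule measurable_resample[OF lam g(1) Gs N(2)])
  show "prob_space (distr (G \<Otimes>\<^sub>M normal_law 0 \<sigma>) (L2_borel lam) (\<lambda>(F, t). resample lam g F t))"
    using m by (rule GN.prob_space_distr)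
  show "prob_space G" "sets G = sets (L2_borel lam)" by fact+
  fix H assume H: "H \<in> L2 lam"
  have Hm [measurable]: "L2_inner lam K \<in> borel_measurable (L2_borel lam)" if "K \<in> L2 lam" for K
    using measurable_L2_inner[OF that] .
  define q where "q = L2_inner lam H g"
  define K where "K = L2_class lam (\<lambda>x. 1 *\<^sub>R rep H x + (- (q / n)) *\<^sub>R rep g x)"
  note K = L2_inner_combination[OF H g(1), where u = 1 and v = "- (q / n)", folded K_def]
  have inner: "L2_inner lam H (resample lam g F t) = L2_inner lam K F + q * t" if "F \<in> L2 lam" for F t
    using that by (simp add: L2_inner_resample H g K(2) n_def[symmetric] q_def[symmetric] field_simps)
  have int: "integrable (G \<Otimes>\<^sub>M normal_law 0 \<sigma>) (\<lambda>\<omega>. iexp (L2_inner lam H ((\<lambda>(F, t). resample lam g F t) \<omega>)))"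
    by (rule integrable_bounded_weight[of _ _ 1])
      (use measurable_compose[OF m Hm[OF H]] in \<open>auto intro: GN.finite_measure_axioms\<close>)
  have "(CLINT F|distr (G \<Otimes>\<^sub>M normal_law 0 \<sigma>) (L2_borel lam) (\<lambda>(F, t). resample lam g F t).
      iexp (L2_inner lam H F)) =
      (CLINT \<omega>|(G \<Otimes>\<^sub>M normal_law 0 \<sigma>). iexp (L2_inner lam H ((\<lambda>(F, t). resample lam g F t) \<omega>)))"
    by (rule integral_distr[OF m]) (use Hm[OF H] in measurable)
  also have "\<dots> = (CLINT F|G. CLINT t|normal_law 0 \<sigma>. iexp (L2_inner lam H (resample lam g F t)))"
    using GN.integral_fst'[OF int] by simp
  also have "\<dots> = (CLINT F|G. iexp (L2_inner lam K F) * (CLINT t|normal_law 0 \<sigma>. iexp (q * t)))"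
  proof (rule Bochner_Integration.integral_cong[OF refl])
    fix F assume "F \<in> space G"
    then have "iexp (L2_inner lam H (resample lam g F t)) = iexp (L2_inner lam K F) * iexp (q * t)" for t
      by (simp add: inner spG exp_add[symmetric] distrib_left)
    then show "(CLINT t|normal_law 0 \<sigma>. iexp (L2_inner lam H (resample lam g F t))) =
        iexp (L2_inner lam K F) * (CLINT t|normal_law 0 \<sigma>. iexp (q * t))" by simp
  qed
  also have "\<dots> = (CLINT F|G. iexp (L2_inner lam K F)) * complex_of_real (exp (- (q * \<sigma>)\<^sup>2 / 2))"
    by (simp only: normal_law_properties(6)[OF \<sigma>(1)] integral_mult_left_zero)
  also have "\<dots> = complex_of_real (exp (- (L2_inner lam K (Q K) + (q * \<sigma>)\<^sup>2) / 2))"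
    by (simp add: centered_gaussian_fourier[OF G K(1)] exp_add[symmetric] add_divide_distrib flip: of_real_mult)
  also have "L2_inner lam K (Q K) + (q * \<sigma>)\<^sup>2 = L2_inner lam H (Q H)"
    using covariance_residual[OF G(1,3) g(1) n_def[symmetric] n eig H, folded q_def, folded K_def]
    by (simp add: power_mult_distrib \<sigma>(2))
  finally show "(CLINT F|distr (G \<Otimes>\<^sub>M normal_law 0 \<sigma>) (L2_borel lam) (\<lambda>(F, t). resample lam g F t).
      iexp (L2_inner lam H F)) = (CLINT F|G. iexp (L2_inner lam H F))"
    by (simp add: centered_gaussian_fourier[OF G H])
qed simp

text \<open>
  This equality supplies the measurability of the nondegenerate classes.
\<close>

lemma L2_C1_nondegenerate_eq:
  fixes lam :: "(real ^ 'n) measure"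
  assumes lam: "lam \<in> P2_ac"
  shows "L2_C1_nondegenerate lam = L2_C1 lam \<inter> {F \<in> L2 lam. push lam F \<in> P2_ac}"
proof -
  have p: "prob_space lam" and s: "sets lam = sets borel" and ac: "absolutely_continuous lborel lam"
    using lam by (auto simp: P2_ac_def P2_def)
  have "push lam F \<in> P2_ac \<longleftrightarrow> emeasure lam {x. det (jacobian f (at x)) = 0} = 0"
    if "F \<in> L2 lam" "f \<in> F" "C1_map f" for F f
    using C1_map_push_ac_iff[OF ac s that(3) _ L2_representative(2)[OF that(1,2)]]
      rep_L2_fun[OF that(1)] push_in_P2[OF p that(1)]
    by (simp add: P2_ac_def push_def L2_fun_def)
  then show ?thesis by (auto simp: L2_C1_nondegenerate_def L2_C1_def)
qed

text \<open>
  In terms of differentiable representatives, resampling moves along the line through the residual of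
  \<open>F\<close> in the direction \<open>g\<close>.
\<close>

lemma AE_resample_ac:
  fixes lam :: "(real ^ 'n) measure"
  assumes lam: "lam \<in> P2_ac" and g: "g \<in> L2_C1_nondegenerate lam" and F: "F \<in> L2_C1 lam"
  shows "AE t in lborel. push lam (resample lam g F t) \<in> P2_ac"
proof -
  have p: "prob_space lam" and s: "sets lam = sets borel"
    using lam by (auto simp: P2_ac_def P2_def)
  interpret prob_space lam by fact
  obtain h where gL: "g \<in> L2 lam" and h: "h \<in> g" "C1_map h" "emeasure lam {x. det (jacobian h (at x)) = 0} = 0"
    using g by (auto simp: L2_C1_nondegenerate_def)
  obtain f where FL: "F \<in> L2 lam" and f: "f \<in> F" "C1_map f" using F by (auto simp: L2_C1_def)
  note rg = L2_representative[OF gL h(1)] and rF = L2_representative[OF FL f(1)]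
  define a where "a = L2_inner lam g F / L2_inner lam g g"
  define k where "k = (\<lambda>x. f x + (- a) *\<^sub>R h x)"
  have k: "C1_map k" unfolding k_def using f(2) h(2) by (rule C1_map_add_scaleR)
  have kL: "k \<in> L2_fun lam" unfolding k_def by (intro L2_fun_add L2_fun_scale rg rF)
  have "AE t in lborel. emeasure lam {x. det (jacobian (\<lambda>x. k x + t *\<^sub>R h x) (at x)) = 0} = 0"
    by (rule AE_nondegenerate_on_line[OF sigma_finite_measure_axioms s k h(2,3)])
  then show ?thesis
  proof eventually_elim
    case (elim t)
    let ?l = "\<lambda>x. k x + t *\<^sub>R h x"
    have lL: "?l \<in> L2_fun lam" by (intro L2_fun_add L2_fun_scale kL rg)
    have eq: "resample lam g F t = L2_class lam ?l"
      unfolding resample_def a_def[symmetric]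
    proof (rule L2_class_cong)
      show "(\<lambda>x. rep F x + (t - a) *\<^sub>R rep g x) \<in> L2_fun lam"
        by (intro L2_fun_add L2_fun_scale rep_L2_fun FL gL)
      show "AE x in lam. rep F x + (t - a) *\<^sub>R rep g x = k x + t *\<^sub>R h x"
        using rF(2) rg(2) by eventually_elim (simp add: k_def algebra_simps)
    qed (rule lL)
    have "?l \<in> L2_class lam ?l"
      using lL by (simp add: L2_class_def L2_eq_def)
    moreover have "C1_map ?l" using k h(2) by (rule C1_map_add_scaleR)
    ultimately have "L2_class lam ?l \<in> L2_C1_nondegenerate lam"
      using L2_class_in[OF lL] elim unfolding L2_C1_nondegenerate_def by blast
    then show ?case by (simp add: eq L2_C1_nondegenerate_eq[OF lam])
  qed
qed

theorem lemma2p6: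
  fixes lam :: "(real ^ 'n) measure"
    and D :: "'n field_class set"
    and A :: "'n field_class \<Rightarrow> 'n field_class"
    and G :: "'n field_class measure"
  assumes "lam \<in> P2_ac"
    and "L2_self_adjoint lam D A"
    and "L2_strictly_positive lam D A"
    and "bij_betw A D (L2 lam)"
    and "L2_trace_class lam (inv_into D A)"
    and "L2_gaussian lam G"
    and "L2_centered lam G"
    and "L2_covariance lam G (inv_into D A)"
    and "measure G (L2_C1 lam) = 1"
    and "\<exists>g \<in> L2_C1_nondegenerate lam. L2_eigenvector lam D A g"
  shows "measure G (L2_C1_nondegenerate lam) = 1 \<and>
         measure G {F \<in> L2 lam. push lam F \<in> P2_ac} = 1"
proof -
  have lam: "prob_space lam" "sets lam = sets borel" using assms(1) by (auto simp: P2_ac_def P2_def)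
  have Gp: "prob_space G" and Gs: "sets G = sets (L2_borel lam)"
    using assms(6) by (auto simp: L2_gaussian_def)
  have spG: "space G = L2 lam" using sets_eq_imp_space_eq[OF Gs] by simp
  interpret G: prob_space G by fact
  obtain g c where g: "g \<in> L2_C1_nondegenerate lam" "g \<in> D" "g \<noteq> L2_zero lam" "A g = L2_scale lam c g"
    using assms(10) by (auto simp: L2_eigenvector_def)
  have gL: "g \<in> L2 lam" using g(1) by (simp add: L2_C1_nondegenerate_def)
  have D: "D \<subseteq> L2 lam"
    using assms(2) by (simp add: L2_self_adjoint_def L2_operator_def L2_subspace_def)
  have op: "L2_operator lam (L2 lam) (inv_into D A)"
    using assms(5) by (simp add: L2_trace_class_def L2_bounded_operator_def)
  note eig = eigenvector_of_inverse[OF op D assms(3,4) g(2,3,4)]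
  define \<sigma> where "\<sigma> = 1 / sqrt (c * L2_inner lam g g)"
  have \<sigma>: "\<sigma> > 0" using eig(1) L2_inner_self_pos[OF gL g(3)] by (simp add: \<sigma>_def)
  note N = normal_law_properties[OF less_imp_le[OF \<sigma>], of 0]
  interpret N: prob_space "normal_law 0 \<sigma>" by fact
  interpret GN: pair_prob_space G "normal_law 0 \<sigma>" ..
  have law: "distr (G \<Otimes>\<^sub>M normal_law 0 \<sigma>) (L2_borel lam) (\<lambda>(F, t). resample lam g F t) = G"
    unfolding \<sigma>_def by (rule distr_resample[OF lam assms(6,7,8) gL g(3) eig])
  have m: "(\<lambda>(F, t). resample lam g F t) \<in> G \<Otimes>\<^sub>M normal_law 0 \<sigma> \<rightarrow>\<^sub>M L2_borel lam"
    by (rule measurable_resample[OF lam gL Gs N(2)])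
  let ?AC = "{F \<in> L2 lam. push lam F \<in> P2_ac}"
  have AC: "?AC \<in> sets (L2_borel lam)" by (rule sets_push_P2_ac[OF lam(1)])
  \<comment> \<open>A set that is not measurable has measure \<open>0\<close> by convention, so measure one entails measurability.\<close>
  have C1: "AE F in G. F \<in> L2_C1 lam"
    using assms(9) G.AE_in_set_eq_1[of "L2_C1 lam"] measure_notin_sets[of "L2_C1 lam" G] by fastforce
  \<comment> \<open>For a fixed sample, almost every \<open>t\<close> is good; by the invariance of \<open>G\<close>, so is almost every sample.\<close>
  then have "AE F in G. AE t in normal_law 0 \<sigma>. resample lam g F t \<in> ?AC"
  proof eventually_elim
    case (elim F)
    then have FL: "F \<in> L2 lam" by (simp add: L2_C1_def)
    have "AE t in lborel. resample lam g F t \<in> ?AC"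
      using AE_resample_ac[OF assms(1) g(1) elim] by eventually_elim (simp add: resample_in gL FL)
    then have "AE t in lborel. 0 < ennreal (normal_density 0 \<sigma> t) \<longrightarrow> resample lam g F t \<in> ?AC"
      by eventually_elim simp
    then have "AE t in density lborel (normal_density 0 \<sigma>). resample lam g F t \<in> ?AC"
      by (subst AE_density) simp_all
    then show ?case using \<sigma> by (simp only: normal_law_def less_imp_neq[OF \<sigma>, symmetric] if_False)
  qed
  then have "AE \<omega> in G \<Otimes>\<^sub>M normal_law 0 \<sigma>. (\<lambda>(F, t). resample lam g F t) \<omega> \<in> ?AC"
    by (intro GN.AE_pair_measure) (use measurable_sets[OF m AC] in \<open>auto simp: vimage_def Int_def conj_commute\<close>)
  then have "AE F in distr (G \<Otimes>\<^sub>M normal_law 0 \<sigma>) (L2_borel lam) (\<lambda>(F, t). resample lam g F t). F \<in> ?AC"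
    by (subst AE_distr_iff[OF m]) (use AC in \<open>auto simp: Int_def conj_commute\<close>)
  then have ac: "AE F in G. F \<in> ?AC" by (simp only: law)
  have C1s: "L2_C1 lam \<in> sets G" using assms(9) measure_notin_sets[of "L2_C1 lam" G] by fastforce
  have ACs: "?AC \<in> sets G" using AC Gs by simp
  have "measure G ?AC = 1" using ac ACs G.prob_eq_1 by simp
  moreover have "measure G (L2_C1 lam \<inter> ?AC) = 1"
    by (subst G.prob_eq_1) (use C1 ac C1s ACs in auto)
  ultimately show ?thesis by (simp add: L2_C1_nondegenerate_eq[OF assms(1)])
qed

end
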